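(* Let $(X,d)$ be a Polish metric space and $\mu$ a Radon measure on $X$. For each $\varepsilon>0$ there is a metric $d^{(\varepsilon)}$ on $X$ which satisfies $$d\le d^{(\varepsilon)}\le(1+\varepsilon)d$$ and such that the local norm on $\mathscr X(\mu)$ corresponding to the metric $d^{(\varepsilon)}$ is strictly convex.
   Context: For a metric space $(X,d)$, $\mathrm{Lip}_b(X)$ is the set of bounded real-valued Lipschitz functions, with norm $\max(\|f\|_\infty,\mathbf L(f))$, $\mathbf L(f)$ being the global Lipschitz constant; it is a dual Banach space (with predual the closed linear span of the point evaluations), and on bounded sets its weak* topology is that of pointwise convergence. For a Radon measure $\mu$, a derivation is a bounded linear map $D:\mathrm{Lip}_b(X)\to L^\infty(\mu)$ that is weak*-weak* continuous and satisfies $D(fg)=fDg+gDf$. The derivations form an $L^\infty(\mu)$-module $\mathscr X(\mu)$, which as a module does not change when the metric is replaced by a biLipschitz equivalent one. The local norm $|D|_{\mathscr X(\mu),loc}\in L^\infty(\mu)$ corresponding to a metric is the least $\lambda\in L^\infty(\mu)$, $\lambda\ge0$, such that $|Dg|\le\lambda$ $\mu$-a.e. for every bounded function $g$ which is $1$-Lipschitz with respect to that metric. The local norm on $\mathscr X(\mu)$ is called strictly convex if: whenever $D_1,D_2\in\mathscr X(\mu)$ and $U$ is a Borel set with $|D_1+D_2|_{\mathscr X(\mu),loc}(x)=|D_1|_{\mathscr X(\mu),loc}(x)+|D_2|_{\mathscr X(\mu),loc}(x)$ for $\mu$-a.e. $x\in U$, then there are Borel sets $V_1,V_2$ and nonnegative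 $\lambda_1\in L^\infty(\mu\llcorner V_1)$, $\lambda_2\in L^\infty(\mu\llcorner V_2)$ (extended by $0$) such that $\mu(U\setminus(V_1\cup V_2))=0$, $\chi_{V_1}D_1=\lambda_1D_2$ and $\chi_{V_2}D_2=\lambda_2D_1$. *)

theory Defs
  imports "HOL-Analysis.Analysis"
begin

text \<open>The space \<open>(X, d)\<close> is a type of class \<^class>\<open>polish_space\<close> (complete, second
  countable) with \<open>d\<close> = \<^const>\<open>dist\<close>.\<close>

text \<open>On a metric space, an inner regular Borel measure is locally finite iff it is finite on
  compact sets, so the usual variants of this definition agree.\<close>

definition radon_measure :: "'a::polish_space measure \<Rightarrow> bool" where
  "radon_measure \<mu> \<longleftrightarrow>
     sets \<mu> = sets borel \<and>
     (\<forall>x. \<exists>W. open W \<and> x \<in> W \<and> emeasure \<mu> W < \<infinity>) \<and>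
     (\<forall>A\<in>sets borel. emeasure \<mu> A = (SUP K\<in>{K. compact K \<and> K \<subseteq> A}. emeasure \<mu> K))"

definition Lip_b :: "('a::metric_space \<Rightarrow> real) set" where
  "Lip_b = {f. bounded (range f) \<and> (\<exists>C. C-lipschitz_on UNIV f)}"

definition lip_const :: "('a::metric_space \<Rightarrow> real) \<Rightarrow> real" where
  "lip_const f = Inf {C. C-lipschitz_on UNIV f}"

definition Lip_b_norm :: "('a::metric_space \<Rightarrow> real) \<Rightarrow> real" where
  "Lip_b_norm f = max (SUP x. \<bar>f x\<bar>) (lip_const f)"

text \<open>The predual of \<open>Lip_b\<close>: functionals that can be approximated in the dual norm by finite
  linear combinations of point evaluations. Such a functional is automatically linear and bounded
  on \<open>Lip_b\<close>; its values off \<open>Lip_b\<close> are irrelevant.\<close>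

definition Lip_b_predual :: "(('a::metric_space \<Rightarrow> real) \<Rightarrow> real) set" where
  "Lip_b_predual = {\<phi>. \<forall>e>0. \<exists>S c. finite S \<and>
     (\<forall>f\<in>Lip_b. \<bar>\<phi> f - (\<Sum>x\<in>S. c x * f x)\<bar> \<le> e * Lip_b_norm f)}"

definition weak_star_Lip_b :: "('a::metric_space \<Rightarrow> real) topology" where
  "weak_star_Lip_b = topology_generated_by
     {{f \<in> Lip_b. \<phi> f \<in> W} | \<phi> W. \<phi> \<in> Lip_b_predual \<and> open W}"

text \<open>Elements of \<open>L\<^sup>\<infinity>(\<mu>)\<close> are given by representatives; equality and order between them are
  always taken almost everywhere.\<close>

definition Linf :: "'a measure \<Rightarrow> ('a \<Rightarrow> real) set" where
  "Linf \<mu> = {h \<in> borel_measurable \<mu>. \<exists>C. AE x in \<mu>. \<bar>h x\<bar> \<le> C}"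

definition Linf_norm :: "'a measure \<Rightarrow> ('a \<Rightarrow> real) \<Rightarrow> real" where
  "Linf_norm \<mu> h = Inf {C. 0 \<le> C \<and> (AE x in \<mu>. \<bar>h x\<bar> \<le> C)}"

text \<open>The topology \<open>\<sigma>(L\<^sup>\<infinity>, L\<^sup>1)\<close>, pulled back to representatives. A map into \<open>Linf \<mu>\<close> is continuous
  for it iff the induced map into the quotient is weak* continuous.\<close>

definition weak_star_Linf :: "'a measure \<Rightarrow> ('a \<Rightarrow> real) topology" where
  "weak_star_Linf \<mu> = topology_generated_by
     {{h \<in> Linf \<mu>. (\<integral>x. h x * g x \<partial>\<mu>) \<in> W} | g W. integrable \<mu> g \<and> open W}"

text \<open>The elements of \<open>\<X>(\<mu>)\<close>. Only the values of \<open>D\<close> on \<open>Lip_b\<close> matter, and these only up to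
  null sets.\<close>

definition derivation ::
    "'a::polish_space measure \<Rightarrow> (('a \<Rightarrow> real) \<Rightarrow> ('a \<Rightarrow> real)) \<Rightarrow> bool" where
  "derivation \<mu> D \<longleftrightarrow>
     (\<forall>f\<in>Lip_b. D f \<in> Linf \<mu>) \<and>
     (\<forall>f\<in>Lip_b. \<forall>g\<in>Lip_b. \<forall>a b. AE x in \<mu>.
        D (\<lambda>y. a * f y + b * g y) x = a * D f x + b * D g x) \<and>
     (\<exists>C. \<forall>f\<in>Lip_b. Linf_norm \<mu> (D f) \<le> C * Lip_b_norm f) \<and>
     continuous_map weak_star_Lip_b (weak_star_Linf \<mu>) D \<and>
     (\<forall>f\<in>Lip_b. \<forall>g\<in>Lip_b. AE x in \<mu>.
        D (\<lambda>y. f y * g y) x = f x * D g x + g x * D f x)"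

definition local_norm_bound ::
    "'a measure \<Rightarrow> ('a \<Rightarrow> 'a \<Rightarrow> real) \<Rightarrow> (('a \<Rightarrow> real) \<Rightarrow> ('a \<Rightarrow> real)) \<Rightarrow> ('a \<Rightarrow> real) \<Rightarrow> bool"
where
  "local_norm_bound \<mu> \<rho> D l \<longleftrightarrow>
     l \<in> Linf \<mu> \<and> (AE x in \<mu>. 0 \<le> l x) \<and>
     (\<forall>g. bounded (range g) \<and> (\<forall>x y. \<bar>g x - g y\<bar> \<le> \<rho> x y) \<longrightarrow>
        (AE x in \<mu>. \<bar>D g x\<bar> \<le> l x))"

text \<open>The local norm corresponding to the metric \<open>\<rho>\<close>. Being a least element for the almost
  everywhere order, it is determined up to a null set; some representative is chosen.\<close>

definition local_norm ::
    "'a measure \<Rightarrow> ('a \<Rightarrow> 'a \<Rightarrow> real) \<Rightarrow> (('a \<Rightarrow> real) \<Rightarrow> ('a \<Rightarrow> real)) \<Rightarrow> ('a \<Rightarrow> real)"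
where
  "local_norm \<mu> \<rho> D = (SOME l. local_norm_bound \<mu> \<rho> D l \<and>
     (\<forall>l'. local_norm_bound \<mu> \<rho> D l' \<longrightarrow> (AE x in \<mu>. l x \<le> l' x)))"

definition strictly_convex_local_norm ::
    "'a::polish_space measure \<Rightarrow> ('a \<Rightarrow> 'a \<Rightarrow> real) \<Rightarrow> bool" where
  "strictly_convex_local_norm \<mu> \<rho> \<longleftrightarrow>
     (\<forall>D\<^sub>1 D\<^sub>2 U.
        derivation \<mu> D\<^sub>1 \<and> derivation \<mu> D\<^sub>2 \<and> U \<in> sets borel \<and>
        (AE x in \<mu>. x \<in> U \<longrightarrow>
           local_norm \<mu> \<rho> (\<lambda>f x. D\<^sub>1 f x + D\<^sub>2 f x) x = local_norm \<mu> \<rho> D\<^sub>1 x + local_norm \<mu> \<rho> D\<^sub>2 x)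
        \<longrightarrow>
        (\<exists>V\<^sub>1 V\<^sub>2 l\<^sub>1 l\<^sub>2.
           V\<^sub>1 \<in> sets borel \<and> V\<^sub>2 \<in> sets borel \<and>
           l\<^sub>1 \<in> Linf \<mu> \<and> (\<forall>x. 0 \<le> l\<^sub>1 x) \<and> (\<forall>x. x \<notin> V\<^sub>1 \<longrightarrow> l\<^sub>1 x = 0) \<and>
           l\<^sub>2 \<in> Linf \<mu> \<and> (\<forall>x. 0 \<le> l\<^sub>2 x) \<and> (\<forall>x. x \<notin> V\<^sub>2 \<longrightarrow> l\<^sub>2 x = 0) \<and>
           emeasure \<mu> (U - (V\<^sub>1 \<union> V\<^sub>2)) = 0 \<and>
           (\<forall>f\<in>Lip_b. AE x in \<mu>. indicator V\<^sub>1 x * D\<^sub>1 f x = l\<^sub>1 x * D\<^sub>2 f x) \<and>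
           (\<forall>f\<in>Lip_b. AE x in \<mu>. indicator V\<^sub>2 x * D\<^sub>2 f x = l\<^sub>2 x * D\<^sub>1 f x)))"

end

theory Submission imports Defs begin

text \<open>Let \<open>\<phi> j = 2 ^ (- j - 1) * min 1 (dist (s j) \<cdot>)\<close> for a dense sequence \<open>s\<close>. The map
  \<open>\<Phi> = (\<phi> j)\<^sub>j\<close> into \<open>l2\<close> is 1-Lipschitz, so
  \<open>d' x y = dist x y + \<epsilon> * \<parallel>\<Phi> x - \<Phi> y\<parallel>\<close> lies between \<open>dist\<close> and \<open>(1 + \<epsilon>) * dist\<close>.
  Its local norm is \<open>\<bar>D\<bar>' = (SUP j. \<bar>D (min 1 (dist (s j) \<cdot>))\<bar>) + \<epsilon> * \<parallel>D \<Phi>\<parallel>\<close>. The lower bound is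
  tested on the 1-Lipschitz functions \<open>\<plusminus> min 1 (dist (s j) \<cdot>) + \<epsilon> * \<langle>u, \<Phi>\<rangle>\<close> with \<open>u\<close> a unit vector;
  for the upper bound, every \<open>d'\<close>-1-Lipschitz function is locally an infimum of translated
  truncated distances \<open>d' (s j) \<cdot>\<close>, and a bound on \<open>\<bar>D f\<bar>\<close> survives minima and bounded pointwise
  limits. If the local norm is additive at \<open>D\<^sub>1, D\<^sub>2\<close>, then so is the strictly convex \<open>l2\<close> part;
  hence \<open>D\<^sub>1 \<Phi>\<close> and \<open>D\<^sub>2 \<Phi>\<close> are parallel, and \<open>D \<Phi>\<close> determines \<open>D\<close>.\<close>

subsection \<open>Square-summable sequences\<close>

definition l2norm :: "(nat \<Rightarrow> real) \<Rightarrow> real" where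
  "l2norm a = sqrt (\<Sum>j. (a j)\<^sup>2)"

lemma l2norm_nonneg: "summable (\<lambda>j. (a j)\<^sup>2) \<Longrightarrow> 0 \<le> l2norm a"
  by (simp add: l2norm_def suminf_nonneg)

lemma l2norm_power2: "summable (\<lambda>j. (a j)\<^sup>2) \<Longrightarrow> (l2norm a)\<^sup>2 = (\<Sum>j. (a j)\<^sup>2)"
  by (simp add: l2norm_def suminf_nonneg)

lemma L2_set_tendsto_l2norm:
  assumes "summable (\<lambda>j. (a j)\<^sup>2)"
  shows "(\<lambda>m. L2_set a {..<m}) \<longlonglongrightarrow> l2norm a"
  unfolding L2_set_def l2norm_def
  by (intro tendsto_intros summable_LIMSEQ assms)

lemma L2_set_le_l2norm:
  assumes "summable (\<lambda>j. (a j)\<^sup>2)"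
  shows "L2_set a {..<m} \<le> l2norm a"
  unfolding L2_set_def l2norm_def
  by (intro real_sqrt_le_mono sum_le_suminf assms) auto

text \<open>The squares of the weights sum to 1/3, so the norm is at most \<open>B / sqrt 3\<close>.
  The estimate serves both for increments of the embedding and for the derivatives of its
  coordinates.\<close>

lemma
  fixes a :: "nat \<Rightarrow> real"
  assumes "\<And>j. \<bar>a j\<bar> \<le> B * (1/2) ^ Suc j"
  shows summable_geometric_l2: "summable (\<lambda>j. (a j)\<^sup>2)"
    and l2norm_geometric_le: "l2norm a \<le> B"
proof -
  have B: "0 \<le> B"
    using assms[of 0] by (simp add: field_simps)
  have le: "(a j)\<^sup>2 \<le> B\<^sup>2 / 4 * (1/4) ^ j" for j
  proof -
    have "(a j)\<^sup>2 \<le> (B * (1/2) ^ Suc j)\<^sup>2"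
      using assms[of j] by (metis abs_ge_zero power2_abs power_mono)
    also have "\<dots> = B\<^sup>2 / 4 * ((1/2)\<^sup>2) ^ j"
      by (simp add: power_mult_distrib flip: power_mult) (simp add: mult.commute power_mult power2_eq_square)
    finally show ?thesis by (simp add: power2_eq_square)
  qed
  have geo: "(\<lambda>j. B\<^sup>2 / 4 * (1/4) ^ j) sums (B\<^sup>2 / 4 * (1 / (1 - 1/4)))"
    by (intro sums_mult geometric_sums) auto
  show sm: "summable (\<lambda>j. (a j)\<^sup>2)"
    by (rule summable_comparison_test'[OF sums_summable[OF geo], of 0]) (use le in auto)
  have "(\<Sum>j. (a j)\<^sup>2) \<le> B\<^sup>2 / 4 * (1 / (1 - 1/4))"
    using suminf_le[OF le sm sums_summable[OF geo]] sums_unique[OF geo] by simp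
  also have "\<dots> \<le> B\<^sup>2" by simp
  finally have "l2norm a \<le> sqrt (B\<^sup>2)"
    unfolding l2norm_def by (rule real_sqrt_le_mono)
  then show "l2norm a \<le> B" using B by simp
qed

lemma summable_l2_add:
  fixes a b :: "nat \<Rightarrow> real"
  assumes "summable (\<lambda>j. (a j)\<^sup>2)" "summable (\<lambda>j. (b j)\<^sup>2)"
  shows "summable (\<lambda>j. (a j + b j)\<^sup>2)"
proof (rule summable_comparison_test'[of "\<lambda>j. 2 * (a j)\<^sup>2 + 2 * (b j)\<^sup>2" 0])
  show "summable (\<lambda>j. 2 * (a j)\<^sup>2 + 2 * (b j)\<^sup>2)"
    by (intro summable_add summable_mult assms)
  \<comment> \<open>Parallelogram identity: the squares of a + b and a - b add up to the right-hand
    side.\<close>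
  show "norm ((a n + b n)\<^sup>2) \<le> 2 * (a n)\<^sup>2 + 2 * (b n)\<^sup>2" for n
    using zero_le_power2[of "a n - b n"] zero_le_power2[of "a n + b n"]
    unfolding real_norm_def power2_diff power2_sum by linarith
qed

lemma l2norm_triangle:
  fixes a b :: "nat \<Rightarrow> real"
  assumes "summable (\<lambda>j. (a j)\<^sup>2)" "summable (\<lambda>j. (b j)\<^sup>2)"
  shows "l2norm (\<lambda>j. a j + b j) \<le> l2norm a + l2norm b"
proof (rule LIMSEQ_le)
  show "(\<lambda>m. L2_set (\<lambda>j. a j + b j) {..<m}) \<longlonglongrightarrow> l2norm (\<lambda>j. a j + b j)"
    by (intro L2_set_tendsto_l2norm summable_l2_add assms)
  show "(\<lambda>m. L2_set a {..<m} + L2_set b {..<m}) \<longlonglongrightarrow> l2norm a + l2norm b"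
    by (intro tendsto_add L2_set_tendsto_l2norm assms)
  show "\<exists>N. \<forall>m\<ge>N. L2_set (\<lambda>j. a j + b j) {..<m} \<le> L2_set a {..<m} + L2_set b {..<m}"
    by (auto intro: L2_set_triangle_ineq)
qed

text \<open>With p, q, r the norms of a, b and a + b, the squared norm of q a - p b equals p q ((p +
  q)^2 - r^2), which is at most 0 under the hypothesis. Working with q a - p b instead of normalised
  vectors covers zero vectors as well.\<close>

lemma l2norm_triangle_eq_imp_parallel:
  fixes a b :: "nat \<Rightarrow> real"
  assumes a: "summable (\<lambda>j. (a j)\<^sup>2)" and b: "summable (\<lambda>j. (b j)\<^sup>2)"
    and ge: "l2norm a + l2norm b \<le> l2norm (\<lambda>j. a j + b j)"
  shows "l2norm b * a j = l2norm a * b j"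
proof -
  define p q where "p = l2norm a" and "q = l2norm b"
  have pq: "0 \<le> p" "0 \<le> q"
    using a b by (auto simp: p_def q_def l2norm_nonneg)
  have ab: "summable (\<lambda>j. (a j + b j)\<^sup>2)"
    by (rule summable_l2_add[OF a b])
  define r where "r = l2norm (\<lambda>j. a j + b j)"
  have sums: "(\<lambda>j. (a j)\<^sup>2) sums p\<^sup>2" "(\<lambda>j. (b j)\<^sup>2) sums q\<^sup>2" "(\<lambda>j. (a j + b j)\<^sup>2) sums r\<^sup>2"
    unfolding p_def q_def r_def by (simp_all add: l2norm_power2 a b ab summable_sums)
  \<comment> \<open>The mixed term 2 a b is written as (a + b)^2 - a^2 - b^2, so that only three
    series with known sums occur.\<close>
  have "(\<lambda>j. q\<^sup>2 * (a j)\<^sup>2 + p\<^sup>2 * (b j)\<^sup>2 - p * q * ((a j + b j)\<^sup>2 - (a j)\<^sup>2 - (b j)\<^sup>2))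
      sums (q\<^sup>2 * p\<^sup>2 + p\<^sup>2 * q\<^sup>2 - p * q * (r\<^sup>2 - p\<^sup>2 - q\<^sup>2))"
    by (intro sums_diff sums_add sums_mult sums)
  moreover have "q\<^sup>2 * (a j)\<^sup>2 + p\<^sup>2 * (b j)\<^sup>2 - p * q * ((a j + b j)\<^sup>2 - (a j)\<^sup>2 - (b j)\<^sup>2)
      = (q * a j - p * b j)\<^sup>2" for j
    by (simp add: power2_eq_square algebra_simps)
  ultimately have s: "(\<lambda>j. (q * a j - p * b j)\<^sup>2) sums (q\<^sup>2 * p\<^sup>2 + p\<^sup>2 * q\<^sup>2 - p * q * (r\<^sup>2 - p\<^sup>2 - q\<^sup>2))"
    by simp
  have "(p + q)\<^sup>2 \<le> r\<^sup>2"
    using ge pq by (intro power_mono) (auto simp: p_def q_def r_def)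
  then have "p * q * (p + q)\<^sup>2 \<le> p * q * r\<^sup>2"
    using pq by (intro mult_left_mono) auto
  moreover have eq: "q\<^sup>2 * p\<^sup>2 + p\<^sup>2 * q\<^sup>2 - p * q * (r\<^sup>2 - p\<^sup>2 - q\<^sup>2) = p * q * (p + q)\<^sup>2 - p * q * r\<^sup>2"
    by algebra
  ultimately have le0: "q\<^sup>2 * p\<^sup>2 + p\<^sup>2 * q\<^sup>2 - p * q * (r\<^sup>2 - p\<^sup>2 - q\<^sup>2) \<le> 0"
    by (simp only: diff_le_0_iff_le)
  then have "(\<Sum>j. (q * a j - p * b j)\<^sup>2) \<le> 0"
    using le0 by (simp only: sums_unique[OF s, symmetric])
  then have "(\<Sum>j. (q * a j - p * b j)\<^sup>2) = 0"
    by (rule antisym) (rule suminf_nonneg[OF sums_summable[OF s]], simp)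
  then have "(q * a j - p * b j)\<^sup>2 = 0"
    using suminf_eq_zero_iff[OF sums_summable[OF s]] by simp
  then show ?thesis by (simp add: p_def q_def)
qed

lemma L2_set_diff_le:
  "\<bar>L2_set a S - L2_set b S\<bar> \<le> L2_set (\<lambda>j. a j - b j) S"
proof -
  have "L2_set a S \<le> L2_set (\<lambda>j. a j - b j) S + L2_set b S"
    using L2_set_triangle_ineq[of "\<lambda>j. a j - b j" b S] by simp
  moreover have "L2_set b S \<le> L2_set (\<lambda>j. b j - a j) S + L2_set a S"
    using L2_set_triangle_ineq[of "\<lambda>j. b j - a j" a S] by simp
  moreover have "L2_set (\<lambda>j. b j - a j) S = L2_set (\<lambda>j. a j - b j) S"
    by (simp add: L2_set_def power2_commute)
  ultimately show ?thesis by linarith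
qed

lemma sqrt_add_square_diff_le:
  fixes d r s :: real
  shows "\<bar>sqrt (d\<^sup>2 + r\<^sup>2) - sqrt (d\<^sup>2 + s\<^sup>2)\<bar> \<le> \<bar>r - s\<bar>"
  using norm_triangle_ineq3[of "(d, r)" "(d, s)"] by (simp add: norm_Pair)

text \<open>The regularisation tends to 0 while \<open>r\<close> converges, so a single index can
  serve both for removing the regularisation and for passing to infinitely many coordinates.\<close>

lemma tendsto_sqrt_null_add:
  fixes r :: "nat \<Rightarrow> real"
  assumes "r \<longlonglongrightarrow> t" "0 \<le> t"
  shows "(\<lambda>m. sqrt ((1 / real (Suc m))\<^sup>2 + (r m)\<^sup>2)) \<longlonglongrightarrow> t"
proof -
  have "(\<lambda>m. sqrt ((1 / real (Suc m))\<^sup>2 + (r m)\<^sup>2)) \<longlonglongrightarrow> sqrt (0\<^sup>2 + t\<^sup>2)"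
    using LIMSEQ_inverse_real_of_nat
    by (intro tendsto_intros assms(1)) (simp add: inverse_eq_divide)
  then show ?thesis using assms(2) by simp
qed

subsection \<open>Bounded Lipschitz functions\<close>

text \<open>One constant controls supremum and Lipschitz constant, which describes a ball of
  \<open>Lip_b\<close> without infima. Pointwise convergent sequences inside one such ball are those
  along which weak* continuity is used.\<close>

definition lip_bdd :: "real \<Rightarrow> ('a::metric_space \<Rightarrow> real) \<Rightarrow> bool" where
  "lip_bdd K f \<longleftrightarrow> (\<forall>x. \<bar>f x\<bar> \<le> K) \<and> (\<forall>x y. \<bar>f x - f y\<bar> \<le> K * dist x y)"

lemma lip_bddI:
  "\<lbrakk>\<And>x. \<bar>f x\<bar> \<le> K; \<And>x y. \<bar>f x - f y\<bar> \<le> K * dist x y\<rbrakk> \<Longrightarrow> lip_bdd K f"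
  by (simp add: lip_bdd_def)

lemma lip_bdd_abs: "lip_bdd K f \<Longrightarrow> \<bar>f x\<bar> \<le> K"
  and lip_bdd_diff: "lip_bdd K f \<Longrightarrow> \<bar>f x - f y\<bar> \<le> K * dist x y"
  by (simp_all add: lip_bdd_def)

lemma lip_bdd_nonneg: "lip_bdd K f \<Longrightarrow> 0 \<le> K"
  using lip_bdd_abs[of K f] by (meson abs_ge_zero order_trans)

lemma lip_bdd_mono: "lip_bdd K f \<Longrightarrow> K \<le> K' \<Longrightarrow> lip_bdd K' f"
  unfolding lip_bdd_def by (meson mult_right_mono order_trans zero_le_dist)

lemma lip_bdd_const: "\<bar>c\<bar> \<le> K \<Longrightarrow> lip_bdd K (\<lambda>x. c)"
  unfolding lip_bdd_def by (auto intro: mult_nonneg_nonneg)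

lemma lip_bdd_add:
  assumes "lip_bdd K f" "lip_bdd M g"
  shows "lip_bdd (K + M) (\<lambda>x. f x + g x)"
proof (rule lip_bddI)
  show "\<bar>f x + g x\<bar> \<le> K + M" for x
    using lip_bdd_abs[OF assms(1), of x] lip_bdd_abs[OF assms(2), of x] by linarith
  show "\<bar>f x + g x - (f y + g y)\<bar> \<le> (K + M) * dist x y" for x y
    using lip_bdd_diff[OF assms(1), of x y] lip_bdd_diff[OF assms(2), of x y]
    by (simp add: distrib_right)
qed

lemma lip_bdd_cmult:
  assumes "lip_bdd K f"
  shows "lip_bdd (\<bar>c\<bar> * K) (\<lambda>x. c * f x)"
proof (rule lip_bddI)
  show "\<bar>c * f x\<bar> \<le> \<bar>c\<bar> * K" for x
    using lip_bdd_abs[OF assms, of x] by (simp add: abs_mult mult_left_mono)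
  show "\<bar>c * f x - c * f y\<bar> \<le> \<bar>c\<bar> * K * dist x y" for x y
    using mult_left_mono[OF lip_bdd_diff[OF assms, of x y], of "\<bar>c\<bar>"]
    by (simp add: abs_mult mult.assoc flip: right_diff_distrib)
qed

lemma lip_bdd_min:
  assumes "lip_bdd K f" "lip_bdd K g"
  shows "lip_bdd K (\<lambda>x. min (f x) (g x))"
proof (rule lip_bddI)
  show "\<bar>min (f x) (g x)\<bar> \<le> K" for x
    using lip_bdd_abs[OF assms(1), of x] lip_bdd_abs[OF assms(2), of x] by linarith
  show "\<bar>min (f x) (g x) - min (f y) (g y)\<bar> \<le> K * dist x y" for x y
    using lip_bdd_diff[OF assms(1), of x y] lip_bdd_diff[OF assms(2), of x y] by linarith
qed

lemma lip_bdd_mult: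
  assumes f: "lip_bdd K f" and g: "lip_bdd M g"
  shows "lip_bdd (2 * K * M) (\<lambda>x. f x * g x)"
proof (rule lip_bddI)
  have KM: "0 \<le> K" "0 \<le> M"
    using f g by (auto dest: lip_bdd_nonneg)
  show "\<bar>f x * g x\<bar> \<le> 2 * K * M" for x
  proof -
    have "\<bar>f x * g x\<bar> \<le> K * M"
      unfolding abs_mult using lip_bdd_abs[OF f] lip_bdd_abs[OF g] KM by (intro mult_mono) auto
    also have "\<dots> \<le> 2 * K * M" using KM by simp
    finally show ?thesis .
  qed
  show "\<bar>f x * g x - f y * g y\<bar> \<le> 2 * K * M * dist x y" for x y
  proof -
    have "f x * g x - f y * g y = f x * (g x - g y) + (f x - f y) * g y"
      by (simp add: algebra_simps)
    then have "\<bar>f x * g x - f y * g y\<bar> \<le> \<bar>f x\<bar> * \<bar>g x - g y\<bar> + \<bar>f x - f y\<bar> * \<bar>g y\<bar>"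
      by (metis abs_mult abs_triangle_ineq)
    also have "\<dots> \<le> K * (M * dist x y) + K * dist x y * M"
      using lip_bdd_abs[OF f] lip_bdd_abs[OF g] lip_bdd_diff[OF f] lip_bdd_diff[OF g] KM
      by (intro add_mono mult_mono) auto
    finally show ?thesis by (simp add: mult_ac)
  qed
qed

lemma lip_bdd_imp_lipschitz: "lip_bdd K f \<Longrightarrow> K-lipschitz_on UNIV f"
  using lip_bdd_nonneg[of K f] by (auto simp: lipschitz_on_def lip_bdd_def dist_real_def)

lemma Lip_b_iff: "f \<in> Lip_b \<longleftrightarrow> (\<exists>K. lip_bdd K f)"
proof
  assume "f \<in> Lip_b"
  then obtain C B where C: "C-lipschitz_on UNIV f" and B: "\<And>x. \<bar>f x\<bar> \<le> B"
    by (auto simp: Lip_b_def bounded_iff)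
  have "lip_bdd (max B C) f"
  proof (rule lip_bddI)
    show "\<bar>f x\<bar> \<le> max B C" for x using B[of x] by linarith
    show "\<bar>f x - f y\<bar> \<le> max B C * dist x y" for x y
      using lipschitz_onD[OF C, of x y] mult_right_mono[of C "max B C" "dist x y"]
      by (simp add: dist_real_def)
  qed
  then show "\<exists>K. lip_bdd K f" ..
next
  assume "\<exists>K. lip_bdd K f"
  then obtain K where K: "lip_bdd K f" ..
  then have "bounded (range f)"
    by (auto simp: bounded_iff lip_bdd_def)
  with K show "f \<in> Lip_b"
    by (auto simp: Lip_b_def intro: lip_bdd_imp_lipschitz)
qed

lemma Lip_bI: "lip_bdd K f \<Longrightarrow> f \<in> Lip_b"
  by (auto simp: Lip_b_iff)

lemma Lip_b_norm_le:
  assumes "lip_bdd K f"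
  shows "Lip_b_norm f \<le> K"
proof -
  have "(SUP x. \<bar>f x\<bar>) \<le> K"
    by (rule cSUP_least) (use assms in \<open>auto simp: lip_bdd_def\<close>)
  moreover have "lip_const f \<le> K"
    unfolding lip_const_def
    by (rule cInf_lower) (use assms in \<open>auto simp: lip_bdd_imp_lipschitz bdd_below_def dest: lipschitz_on_nonneg\<close>)
  ultimately show ?thesis by (simp add: Lip_b_norm_def)
qed

lemma Lip_b_norm_nonneg:
  assumes "f \<in> Lip_b"
  shows "0 \<le> Lip_b_norm f"
proof -
  have "0 \<le> \<bar>f undefined\<bar>" by simp
  also have "\<dots> \<le> (SUP x. \<bar>f x\<bar>)"
    using assms by (intro cSUP_upper) (auto simp: Lip_b_iff lip_bdd_def bdd_above_def)
  finally show ?thesis by (simp add: Lip_b_norm_def)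
qed

lemma Lip_b_const: "(\<lambda>x. c) \<in> Lip_b"
  by (rule Lip_bI[OF lip_bdd_const[OF order_refl]])

lemma Lip_b_cmult: "f \<in> Lip_b \<Longrightarrow> (\<lambda>x. c * f x) \<in> Lip_b"
  by (auto simp: Lip_b_iff intro: lip_bdd_cmult)

lemma Lip_b_add: "f \<in> Lip_b \<Longrightarrow> g \<in> Lip_b \<Longrightarrow> (\<lambda>x. f x + g x) \<in> Lip_b"
  by (auto simp: Lip_b_iff intro: lip_bdd_add)

lemma Lip_b_diff: "f \<in> Lip_b \<Longrightarrow> g \<in> Lip_b \<Longrightarrow> (\<lambda>x. f x - g x) \<in> Lip_b"
  using Lip_b_add[of f "\<lambda>x. -1 * g x"] Lip_b_cmult[of g "-1"] by simp

lemma Lip_b_mult: "f \<in> Lip_b \<Longrightarrow> g \<in> Lip_b \<Longrightarrow> (\<lambda>x. f x * g x) \<in> Lip_b"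
  by (auto simp: Lip_b_iff intro: lip_bdd_mult)

lemma Lip_b_sum: "(\<And>j. j < (m::nat) \<Longrightarrow> h j \<in> Lip_b) \<Longrightarrow> (\<lambda>x. \<Sum>j<m. h j x) \<in> Lip_b"
  by (induction m) (auto intro: Lip_b_const Lip_b_add)

lemma Lip_b_comp:
  assumes f: "f \<in> Lip_b" and F: "\<And>s t. \<bar>F s - F t\<bar> \<le> \<bar>s - t\<bar>"
  shows "(\<lambda>x. F (f x)) \<in> Lip_b"
proof -
  from f obtain K where K: "lip_bdd K f" by (auto simp: Lip_b_iff)
  have "lip_bdd (\<bar>F 0\<bar> + K) (\<lambda>x. F (f x))"
  proof (rule lip_bddI)
    show "\<bar>F (f x)\<bar> \<le> \<bar>F 0\<bar> + K" for x
      using F[of "f x" 0] lip_bdd_abs[OF K, of x] by linarith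
    show "\<bar>F (f x) - F (f y)\<bar> \<le> (\<bar>F 0\<bar> + K) * dist x y" for x y
      using F[of "f x" "f y"] lip_bdd_diff[OF K, of x y] mult_nonneg_nonneg[OF abs_ge_zero[of "F 0"] zero_le_dist[of x y]]
      unfolding distrib_right by linarith
  qed
  then show ?thesis by (rule Lip_bI)
qed

lemma lip_bdd_limit:
  fixes F :: "nat \<Rightarrow> 'a::metric_space \<Rightarrow> real"
  assumes F: "\<And>m. lip_bdd K (F m)" and lim: "\<And>x. (\<lambda>m. F m x) \<longlonglongrightarrow> f x"
  shows "lip_bdd K f"
proof (rule lip_bddI)
  show "\<bar>f x\<bar> \<le> K" for x
    by (rule LIMSEQ_le_const2[OF tendsto_rabs[OF lim]]) (auto intro: lip_bdd_abs[OF F])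
  show "\<bar>f x - f y\<bar> \<le> K * dist x y" for x y
    by (rule LIMSEQ_le_const2[OF tendsto_rabs[OF tendsto_diff[OF lim lim]]])
      (auto intro: lip_bdd_diff[OF F])
qed

text \<open>The square root is a regularised Euclidean norm, and r is mapped to
  \<open>sqrt (\<delta>^2 + r^2)\<close> in a 1-Lipschitz way. The resulting constant depends on
  \<open>m\<close> only through \<open>K\<close>, so approximations in growing dimension can stay in
  one ball.\<close>

lemma lip_bdd_sqrt:
  assumes "\<And>x. L2_set (\<lambda>j. h j x) {..<m::nat} \<le> K"
    and "\<And>x y. L2_set (\<lambda>j. h j x - h j y) {..<m} \<le> K * dist x y"
  shows "lip_bdd (\<bar>\<delta>\<bar> + K) (\<lambda>x. sqrt (\<delta>\<^sup>2 + (L2_set (\<lambda>j. h j x) {..<m})\<^sup>2))"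
proof (rule lip_bddI)
  show "\<bar>sqrt (\<delta>\<^sup>2 + (L2_set (\<lambda>j. h j x) {..<m})\<^sup>2)\<bar> \<le> \<bar>\<delta>\<bar> + K" for x
    using sqrt_add_square_diff_le[of \<delta> "L2_set (\<lambda>j. h j x) {..<m}" 0] assms(1)[of x]
    by simp
  show "\<bar>sqrt (\<delta>\<^sup>2 + (L2_set (\<lambda>j. h j x) {..<m})\<^sup>2) - sqrt (\<delta>\<^sup>2 + (L2_set (\<lambda>j. h j y) {..<m})\<^sup>2)\<bar>
      \<le> (\<bar>\<delta>\<bar> + K) * dist x y" for x y
  proof -
    have "\<bar>sqrt (\<delta>\<^sup>2 + (L2_set (\<lambda>j. h j x) {..<m})\<^sup>2) - sqrt (\<delta>\<^sup>2 + (L2_set (\<lambda>j. h j y) {..<m})\<^sup>2)\<bar>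
        \<le> \<bar>L2_set (\<lambda>j. h j x) {..<m} - L2_set (\<lambda>j. h j y) {..<m}\<bar>"
      by (rule sqrt_add_square_diff_le)
    also have "\<dots> \<le> L2_set (\<lambda>j. h j x - h j y) {..<m}"
      by (rule L2_set_diff_le)
    also have "\<dots> \<le> K * dist x y" by (rule assms(2))
    also have "\<dots> \<le> (\<bar>\<delta>\<bar> + K) * dist x y" by (simp add: mult_right_mono)
    finally show ?thesis .
  qed
qed

lemma Lip_b_sqrt:
  assumes "\<And>j. j < (m::nat) \<Longrightarrow> h j \<in> Lip_b"
  shows "(\<lambda>x. sqrt (\<delta>\<^sup>2 + (L2_set (\<lambda>j. h j x) {..<m})\<^sup>2)) \<in> Lip_b"
proof -
  from assms obtain K where K: "\<And>j. j < m \<Longrightarrow> lip_bdd (K j) (h j)"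
    unfolding Lip_b_iff by metis
  \<comment> \<open>Only membership in \<open>Lip_b\<close> is at stake, so the crude bound by the
    l1 norm is enough.\<close>
  have "L2_set (\<lambda>j. h j x) {..<m} \<le> (\<Sum>j<m. K j)" for x
    by (rule order_trans[OF L2_set_le_sum_abs sum_mono]) (use K in \<open>auto intro: lip_bdd_abs\<close>)
  moreover have "L2_set (\<lambda>j. h j x - h j y) {..<m} \<le> (\<Sum>j<m. K j) * dist x y" for x y
    unfolding sum_distrib_right
    by (rule order_trans[OF L2_set_le_sum_abs sum_mono]) (use K in \<open>auto intro: lip_bdd_diff\<close>)
  ultimately have "lip_bdd (\<bar>\<delta>\<bar> + (\<Sum>j<m. K j)) (\<lambda>x. sqrt (\<delta>\<^sup>2 + (L2_set (\<lambda>j. h j x) {..<m})\<^sup>2))"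
    by (rule lip_bdd_sqrt)
  then show ?thesis
    by (rule Lip_bI)
qed

subsection \<open>Weakly continuous derivations\<close>

lemma Linf_measurable: "h \<in> Linf \<mu> \<Longrightarrow> h \<in> borel_measurable \<mu>"
  by (simp add: Linf_def)

lemma integrable_Linf_mult:
  assumes h: "h \<in> Linf \<mu>" and u: "integrable \<mu> u"
  shows "integrable \<mu> (\<lambda>x. h x * u x)"
proof -
  from h obtain C where C: "AE x in \<mu>. \<bar>h x\<bar> \<le> C" and [measurable]: "h \<in> borel_measurable \<mu>"
    by (auto simp: Linf_def)
  have [measurable]: "u \<in> borel_measurable \<mu>" using u by simp
  have "integrable \<mu> (\<lambda>x. C * u x)" using u by simp
  then show ?thesis
  proof (rule Bochner_Integration.integrable_bound)
    show "AE x in \<mu>. norm (h x * u x) \<le> norm (C * u x)"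
      using C
    proof eventually_elim
      case (elim x)
      then have "\<bar>h x\<bar> \<le> \<bar>C\<bar>" by linarith
      then show ?case by (simp add: abs_mult mult_right_mono)
    qed
  qed simp
qed

lemma Linf_add:
  assumes "g \<in> Linf \<mu>" "h \<in> Linf \<mu>"
  shows "(\<lambda>x. g x + h x) \<in> Linf \<mu>"
proof -
  from assms obtain B C where "AE x in \<mu>. \<bar>g x\<bar> \<le> B" "AE x in \<mu>. \<bar>h x\<bar> \<le> C"
    by (auto simp: Linf_def)
  then have "AE x in \<mu>. \<bar>g x + h x\<bar> \<le> B + C" by eventually_elim linarith
  with assms show ?thesis by (auto simp: Linf_def)
qed

lemma Linf_mult:
  assumes "g \<in> Linf \<mu>" "h \<in> Linf \<mu>"
  shows "(\<lambda>x. g x * h x) \<in> Linf \<mu>"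
proof -
  from assms obtain B C where "AE x in \<mu>. \<bar>g x\<bar> \<le> B" "AE x in \<mu>. \<bar>h x\<bar> \<le> C"
    by (auto simp: Linf_def)
  then have "AE x in \<mu>. \<bar>g x * h x\<bar> \<le> B * C"
    by eventually_elim (auto simp: abs_mult intro!: mult_mono)
  with assms show ?thesis by (auto simp: Linf_def)
qed

lemma Linf_bounded:
  assumes "h \<in> borel_measurable \<mu>" "\<And>x. \<bar>h x\<bar> \<le> C"
  shows "h \<in> Linf \<mu>"
  using assms by (auto simp: Linf_def)

lemma Linf_diff:
  assumes "g \<in> Linf \<mu>" "h \<in> Linf \<mu>"
  shows "(\<lambda>x. g x - h x) \<in> Linf \<mu>"
  using Linf_add[OF assms(1) Linf_mult[OF Linf_bounded[of "\<lambda>_. -1" \<mu> 1] assms(2)]] by simp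

context sigma_finite_measure
begin

text \<open>The functions are integrated over pieces of the set \<open>{L < f}\<close> inside
  \<open>A\<close>. On such a piece the integrals of \<open>F m\<close> are at most that of
  \<open>L\<close>, hence so is the integral of the weak limit \<open>f\<close>, which forces the
  piece to be null.\<close>

lemma AE_le_weak_limit:
  fixes F :: "nat \<Rightarrow> 'a \<Rightarrow> real"
  assumes F: "\<And>m. F m \<in> Linf M" and f: "f \<in> Linf M"
    and L[measurable]: "L \<in> borel_measurable M" and A[measurable]: "A \<in> sets M"
    and le: "\<And>m. AE x in M. x \<in> A \<longrightarrow> F m x \<le> L x"
    and lim: "\<And>u. integrable M u \<Longrightarrow> (\<lambda>m. \<integral>x. F m x * u x \<partial>M) \<longlonglongrightarrow> (\<integral>x. f x * u x \<partial>M)"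
  shows "AE x in M. x \<in> A \<longrightarrow> f x \<le> L x"
proof -
  have [measurable]: "f \<in> borel_measurable M" "F m \<in> borel_measurable M" for m
    using f F by (auto intro: Linf_measurable)
  obtain W :: "nat \<Rightarrow> 'a set" where W: "range W \<subseteq> sets M" "(\<Union>i. W i) = space M"
    "\<And>i. emeasure M (W i) \<noteq> \<infinity>"
    using sigma_finite by metis
  have [measurable]: "W i \<in> sets M" for i using W(1) by auto
  \<comment> \<open>The bad set is cut into pieces of finite measure on which \<open>L\<close> is
    bounded, so that the indicator of a piece is an integrable test function.\<close>
  define B where "B i k = {x \<in> space M. x \<in> A \<and> x \<in> W i \<and> \<bar>L x\<bar> \<le> real k \<and> L x < f x}" for i k
  have B[measurable]: "B i k \<in> sets M" for i k
    unfolding B_def by measurable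
  have null: "AE x in M. x \<notin> B i k" for i k
  proof -
    define u :: "'a \<Rightarrow> real" where "u = indicator (B i k)"
    have "emeasure M (B i k) \<le> emeasure M (W i)"
      by (rule emeasure_mono) (auto simp: B_def)
    then have fin: "emeasure M (B i k) < \<infinity>"
      using W(3)[of i] by (simp add: top.not_eq_extremum order_le_less_trans)
    then have u: "integrable M u" by (simp add: u_def)
    \<comment> \<open>The truncation of \<open>L\<close> lies in \<open>Linf M\<close> and agrees
      with \<open>L\<close> on \<open>B i k\<close>.\<close>
    define L' where "L' x = max (- real k) (min (real k) (L x))" for x
    have L': "L' \<in> Linf M"
      by (rule Linf_bounded[of _ _ k]) (auto simp: L'_def[abs_def])
    have L'_eq: "L' x = L x" if "x \<in> B i k" for x
      using that by (auto simp: L'_def B_def)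
    have "(\<integral>x. F m x * u x \<partial>M) \<le> (\<integral>x. L' x * u x \<partial>M)" for m
    proof (rule integral_mono_AE)
      show "AE x in M. F m x * u x \<le> L' x * u x"
        using le[of m] by eventually_elim (auto simp: u_def L'_eq B_def split: split_indicator)
    qed (use F L' u in \<open>auto intro: integrable_Linf_mult\<close>)
    then have "(\<integral>x. f x * u x \<partial>M) \<le> (\<integral>x. L' x * u x \<partial>M)"
      by (intro LIMSEQ_le_const2[OF lim[OF u]]) auto
    moreover have int: "integrable M (\<lambda>x. f x * u x)" "integrable M (\<lambda>x. L' x * u x)"
      using f L' u by (auto intro: integrable_Linf_mult)
    ultimately have le0: "(\<integral>x. f x * u x - L' x * u x \<partial>M) \<le> 0"
      by simp
    have nn: "0 \<le> f x * u x - L' x * u x" for x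
      by (auto simp: u_def L'_eq B_def split: split_indicator)
    have "(\<integral>x. f x * u x - L' x * u x \<partial>M) = 0"
      using le0 nn by (intro antisym integral_nonneg_AE) auto
    then have "AE x in M. f x * u x - L' x * u x = 0"
      using int nn by (subst (asm) integral_nonneg_eq_0_iff_AE) auto
    then show ?thesis
      by eventually_elim (auto simp: u_def L'_eq B_def split: split_indicator_asm)
  qed
  have "AE x in M. \<forall>i k. x \<notin> B i k"
    using null by (simp add: AE_all_countable)
  then show ?thesis
    using AE_space
  proof eventually_elim
    case (elim x)
    show ?case
    proof (intro impI leI notI)
      assume "x \<in> A" "L x < f x"
      moreover obtain i where "x \<in> W i" using elim(2) W(2) by auto
      moreover obtain k where "\<bar>L x\<bar> \<le> real k" using real_arch_simple by blast
      ultimately show False using elim by (auto simp: B_def)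
    qed
  qed
qed

lemma AE_abs_le_weak_limit:
  fixes F :: "nat \<Rightarrow> 'a \<Rightarrow> real"
  assumes F: "\<And>m. F m \<in> Linf M" and f: "f \<in> Linf M"
    and L: "L \<in> borel_measurable M" and A: "A \<in> sets M"
    and le: "\<And>m. AE x in M. x \<in> A \<longrightarrow> \<bar>F m x\<bar> \<le> L x"
    and lim: "\<And>u. integrable M u \<Longrightarrow> (\<lambda>m. \<integral>x. F m x * u x \<partial>M) \<longlonglongrightarrow> (\<integral>x. f x * u x \<partial>M)"
  shows "AE x in M. x \<in> A \<longrightarrow> \<bar>f x\<bar> \<le> L x"
proof -
  have "AE x in M. x \<in> A \<longrightarrow> F m x \<le> L x" for m
    using le[of m] by eventually_elim auto
  then have "AE x in M. x \<in> A \<longrightarrow> f x \<le> L x"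
    by (rule AE_le_weak_limit[OF F f L A _ lim])
  moreover have zero: "(\<lambda>_. 0) \<in> Linf M"
    by (rule Linf_bounded) auto
  moreover have "AE x in M. x \<in> A \<longrightarrow> 0 - f x \<le> L x"
  proof (rule AE_le_weak_limit[OF _ _ L A])
    show "(\<lambda>x. 0 - F m x) \<in> Linf M" "(\<lambda>x. 0 - f x) \<in> Linf M" for m
      using Linf_diff[OF zero F] Linf_diff[OF zero f] by auto
    show "AE x in M. x \<in> A \<longrightarrow> 0 - F m x \<le> L x" for m
      using le[of m] by eventually_elim auto
    show "(\<lambda>m. \<integral>x. (0 - F m x) * u x \<partial>M) \<longlonglongrightarrow> (\<integral>x. (0 - f x) * u x \<partial>M)"
      if "integrable M u" for u
      using tendsto_minus[OF lim[OF that]] by simp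
  qed
  ultimately show ?thesis by eventually_elim auto
qed

end

text \<open>The working form of a derivation: continuity is taken along sequences converging
  pointwise in one ball, tested against an integrable \<open>u\<close>. The class is closed under
  combinations with coefficients in \<open>Linf \<mu>\<close>, so the calculus below also applies to
  sums of derivations and to the combination that tests whether two of them are parallel.\<close>

locale weak_derivation = sigma_finite_measure \<mu> for \<mu> :: "'a::polish_space measure" +
  fixes D :: "('a \<Rightarrow> real) \<Rightarrow> ('a \<Rightarrow> real)"
  assumes sets_borel: "sets \<mu> = sets borel"
    and D_Linf: "f \<in> Lip_b \<Longrightarrow> D f \<in> Linf \<mu>"
    and D_linear: "f \<in> Lip_b \<Longrightarrow> g \<in> Lip_b \<Longrightarrow>
      AE x in \<mu>. D (\<lambda>y. a * f y + b * g y) x = a * D f x + b * D g x"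
    and D_leibniz: "f \<in> Lip_b \<Longrightarrow> g \<in> Lip_b \<Longrightarrow>
      AE x in \<mu>. D (\<lambda>y. f y * g y) x = f x * D g x + g x * D f x"
    and D_weak_continuous: "(\<And>m. lip_bdd K (F m)) \<Longrightarrow> (\<And>x. (\<lambda>m. F m x) \<longlonglongrightarrow> f x) \<Longrightarrow>
      integrable \<mu> u \<Longrightarrow> (\<lambda>m. \<integral>x. D (F m) x * u x \<partial>\<mu>) \<longlonglongrightarrow> (\<integral>x. D f x * u x \<partial>\<mu>)"
begin

section \<open>Calculus rules for derivations\<close>

lemma measurable_D: "f \<in> Lip_b \<Longrightarrow> D f \<in> borel_measurable \<mu>"
  by (intro Linf_measurable D_Linf)

lemma D_add:
  assumes "f \<in> Lip_b" "g \<in> Lip_b"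
  shows "AE x in \<mu>. D (\<lambda>y. f y + g y) x = D f x + D g x"
  using D_linear[OF assms, of 1 1] by simp

lemma D_diff:
  assumes "f \<in> Lip_b" "g \<in> Lip_b"
  shows "AE x in \<mu>. D (\<lambda>y. f y - g y) x = D f x - D g x"
  using D_linear[OF assms, of 1 "-1"] by simp

lemma D_cmult:
  assumes "f \<in> Lip_b"
  shows "AE x in \<mu>. D (\<lambda>y. a * f y) x = a * D f x"
  using D_linear[OF assms assms, of a 0] by simp

text \<open>The Leibniz rule for 1 = 1 * 1 gives D 1 = 2 D 1.\<close>

lemma D_const: "AE x in \<mu>. D (\<lambda>y. c) x = 0"
proof -
  have "AE x in \<mu>. D (\<lambda>y. 1) x = 0"
    using D_leibniz[OF Lip_b_const Lip_b_const, of 1 1] by simp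
  with D_cmult[OF Lip_b_const, of c 1] show ?thesis
    by eventually_elim simp
qed

lemma D_sum:
  assumes "\<And>j. j < (m::nat) \<Longrightarrow> h j \<in> Lip_b"
  shows "AE x in \<mu>. D (\<lambda>y. \<Sum>j<m. h j y) x = (\<Sum>j<m. D (h j) x)"
  using assms
proof (induction m)
  case 0
  then show ?case using D_const[of 0] by simp
next
  case (Suc m)
  then have "AE x in \<mu>. D (\<lambda>y. (\<Sum>j<m. h j y) + h m y) x = D (\<lambda>y. \<Sum>j<m. h j y) x + D (h m) x"
    by (intro D_add Lip_b_sum) auto
  moreover have "AE x in \<mu>. D (\<lambda>y. \<Sum>j<m. h j y) x = (\<Sum>j<m. D (h j) x)"
    using Suc by simp
  ultimately show ?case by eventually_elim simp
qed

text \<open>Locality: in 0 = \<open>\<eta> * D h + h * D \<eta>\<close> the second term vanishes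
  wherever \<open>\<eta>\<close> is nonzero, because \<open>h\<close> is 0 there.\<close>

lemma D_local:
  assumes \<eta>: "\<eta> \<in> Lip_b" and h: "h \<in> Lip_b" and "\<And>x. \<eta> x * h x = 0"
  shows "AE x in \<mu>. \<eta> x \<noteq> 0 \<longrightarrow> D h x = 0"
proof -
  have eq: "(\<lambda>x. \<eta> x * h x) = (\<lambda>x. 0)" using assms(3) by auto
  have "AE x in \<mu>. D (\<lambda>x. 0) x = \<eta> x * D h x + h x * D \<eta> x"
    using D_leibniz[OF \<eta> h] by (simp add: eq)
  with D_const[of 0] show ?thesis
  proof eventually_elim
    case (elim x)
    then show ?case using assms(3)[of x] by auto
  qed
qed

text \<open>Applying the Leibniz rule to both sides of \<open>p\<^sup>2 = \<delta>\<^sup>2 + (\<Sum>j<m. (h j)\<^sup>2)\<close> gives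
  \<open>p * D p = (\<Sum>j<m. h j * D (h j))\<close>, so no chain rule is needed.\<close>

lemma D_sqrt_le:
  assumes "0 < \<delta>" and h: "\<And>j. j < (m::nat) \<Longrightarrow> h j \<in> Lip_b"
  defines "p \<equiv> \<lambda>x. sqrt (\<delta>\<^sup>2 + (L2_set (\<lambda>j. h j x) {..<m})\<^sup>2)"
  shows "AE x in \<mu>. \<bar>D p x\<bar> \<le> L2_set (\<lambda>j. D (h j) x) {..<m}"
proof -
  have p: "p \<in> Lip_b"
    unfolding p_def by (rule Lip_b_sqrt[OF h])
  \<comment> \<open>Positivity, which comes from \<delta>, allows \<open>p x\<close> to be cancelled
    at the end.\<close>
  have p_pos: "0 < p x" for x
    using \<open>0 < \<delta>\<close> by (simp add: p_def add_pos_nonneg)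
  have p_ge: "L2_set (\<lambda>j. h j x) {..<m} \<le> p x" for x
    by (simp add: p_def real_le_rsqrt)
  have "(\<lambda>x. p x * p x) = (\<lambda>x. \<delta>\<^sup>2 + (\<Sum>j<m. h j x * h j x))"
    by (auto simp: p_def L2_set_def sum_nonneg power2_eq_square)
  then have "AE x in \<mu>. D (\<lambda>x. \<delta>\<^sup>2 + (\<Sum>j<m. h j x * h j x)) x = p x * D p x + p x * D p x"
    using D_leibniz[OF p p] by simp
  moreover have "AE x in \<mu>. D (\<lambda>x. \<delta>\<^sup>2 + (\<Sum>j<m. h j x * h j x)) x
      = D (\<lambda>x. \<delta>\<^sup>2) x + D (\<lambda>x. \<Sum>j<m. h j x * h j x) x"
    using h by (intro D_add Lip_b_const Lip_b_sum Lip_b_mult)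
  moreover have "AE x in \<mu>. D (\<lambda>x. \<Sum>j<m. h j x * h j x) x = (\<Sum>j<m. D (\<lambda>x. h j x * h j x) x)"
    using h by (intro D_sum Lip_b_mult)
  moreover have "AE x in \<mu>. \<forall>j\<in>{..<m}. D (\<lambda>x. h j x * h j x) x = h j x * D (h j) x + h j x * D (h j) x"
    using h by (intro AE_finite_allI D_leibniz) auto
  ultimately show ?thesis
    using D_const[of "\<delta>\<^sup>2"]
  proof eventually_elim
    case (elim x)
    have "2 * (p x * D p x) = (\<Sum>j<m. 2 * (h j x * D (h j) x))"
      using elim by simp
    then have "p x * D p x = (\<Sum>j<m. h j x * D (h j) x)"
      by (simp flip: sum_distrib_left)
    then have "p x * \<bar>D p x\<bar> = \<bar>\<Sum>j<m. h j x * D (h j) x\<bar>"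
      using p_pos[of x] by (metis abs_mult abs_of_pos)
    also have "\<dots> \<le> (\<Sum>j<m. \<bar>h j x\<bar> * \<bar>D (h j) x\<bar>)"
      by (rule order_trans[OF sum_abs]) (simp add: abs_mult)
    also have "\<dots> \<le> L2_set (\<lambda>j. h j x) {..<m} * L2_set (\<lambda>j. D (h j) x) {..<m}"
      by (rule L2_set_mult_ineq)
    also have "\<dots> \<le> p x * L2_set (\<lambda>j. D (h j) x) {..<m}"
      by (intro mult_right_mono p_ge) simp
    finally show ?case using p_pos[of x] by simp
  qed
qed

text \<open>Weak continuity turns pointwise convergence within a ball into weak convergence of the
  derivatives, and a bound by \<open>L\<close> on \<open>A\<close> passes to weak limits.\<close>

lemma D_bound_closed:
  assumes F: "\<And>m. lip_bdd K (F m)" and lim: "\<And>x. (\<lambda>m. F m x) \<longlonglongrightarrow> f x"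
    and L: "L \<in> borel_measurable \<mu>" and A: "A \<in> sets \<mu>"
    and le: "\<And>m. AE x in \<mu>. x \<in> A \<longrightarrow> \<bar>D (F m) x\<bar> \<le> L x"
  shows "AE x in \<mu>. x \<in> A \<longrightarrow> \<bar>D f x\<bar> \<le> L x"
proof -
  have "lip_bdd K f"
    by (rule lip_bdd_limit[OF F lim])
  with F show ?thesis
    by (intro AE_abs_le_weak_limit[OF _ _ L A le D_weak_continuous[OF F lim]] D_Linf Lip_bI)
qed

text \<open>The minimum is half the sum minus half of |h|, where h = f - g. The absolute value is
  the limit of \<open>sqrt (\<delta>^2 + h^2)\<close>, whose derivative is bounded by |D h| by
  \<open>D_sqrt_le\<close> in dimension one.\<close>

lemma D_bound_min:
  assumes f: "f \<in> Lip_b" and g: "g \<in> Lip_b"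
    and L: "L \<in> borel_measurable \<mu>" and A: "A \<in> sets \<mu>"
    and Df: "AE x in \<mu>. x \<in> A \<longrightarrow> \<bar>D f x\<bar> \<le> L x"
    and Dg: "AE x in \<mu>. x \<in> A \<longrightarrow> \<bar>D g x\<bar> \<le> L x"
  shows "AE x in \<mu>. x \<in> A \<longrightarrow> \<bar>D (\<lambda>y. min (f y) (g y)) x\<bar> \<le> L x"
proof -
  define h where "h x = f x - g x" for x
  have h: "h \<in> Lip_b" unfolding h_def by (rule Lip_b_diff[OF f g])
  define \<delta> where "\<delta> m = 1 / real (Suc m)" for m
  define p where "p m x = sqrt ((\<delta> m)\<^sup>2 + (L2_set (\<lambda>j. h x) {..<(1::nat)})\<^sup>2)" for m x
  define F where "F m x = 1/2 * (f x + g x) + (-1/2) * p m x" for m x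
  have L2: "L2_set (\<lambda>j. t) {..<(1::nat)} = \<bar>t\<bar>" for t by (simp add: L2_set_def)
  have p: "p m \<in> Lip_b" for m
    unfolding p_def by (intro Lip_b_sqrt h)
  obtain Kf Kg Kh where K: "lip_bdd Kf f" "lip_bdd Kg g" "lip_bdd Kh h"
    using f g h by (auto simp: Lip_b_iff)
  show ?thesis
  proof (rule D_bound_closed[where F = F])
    show "lip_bdd (\<bar>1/2\<bar> * (Kf + Kg) + \<bar>-1/2\<bar> * (1 + Kh)) (F m)" for m
    proof -
      have "lip_bdd (\<bar>\<delta> m\<bar> + Kh) (p m)"
        unfolding p_def
        by (rule lip_bdd_sqrt) (simp_all only: L2 lip_bdd_abs[OF K(3)] lip_bdd_diff[OF K(3)])
      then have "lip_bdd (1 + Kh) (p m)"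
        by (rule lip_bdd_mono) (simp add: \<delta>_def)
      then show ?thesis
        unfolding F_def by (intro lip_bdd_add lip_bdd_cmult K)
    qed
    show "(\<lambda>m. F m x) \<longlonglongrightarrow> min (f x) (g x)" for x
    proof -
      have "(\<lambda>m. p m x) \<longlonglongrightarrow> \<bar>h x\<bar>"
        unfolding p_def \<delta>_def L2 by (rule tendsto_sqrt_null_add) auto
      then have "(\<lambda>m. F m x) \<longlonglongrightarrow> 1/2 * (f x + g x) + (-1/2) * \<bar>h x\<bar>"
        unfolding F_def by (intro tendsto_intros)
      moreover have "1/2 * (f x + g x) + (-1/2) * \<bar>h x\<bar> = min (f x) (g x)"
        by (simp add: h_def min_def abs_if field_simps)
      ultimately show ?thesis by simp
    qed
    show "AE x in \<mu>. x \<in> A \<longrightarrow> \<bar>D (F m) x\<bar> \<le> L x" for m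
    proof -
      have "AE x in \<mu>. \<bar>D (p m) x\<bar> \<le> L2_set (\<lambda>j. D h x) {..<(1::nat)}"
        unfolding p_def by (rule D_sqrt_le[OF _ h]) (simp add: \<delta>_def)
      moreover have "AE x in \<mu>. D h x = D f x - D g x"
        unfolding h_def by (rule D_diff[OF f g])
      moreover have "AE x in \<mu>. D (\<lambda>y. f y + g y) x = D f x + D g x"
        by (rule D_add[OF f g])
      moreover have "AE x in \<mu>. D (F m) x = 1/2 * D (\<lambda>y. f y + g y) x + (-1/2) * D (p m) x"
        unfolding F_def by (intro D_linear Lip_b_add f g p)
      ultimately show ?thesis
        using Df Dg
      proof eventually_elim
        case (elim x)
        show ?case
        proof
          assume "x \<in> A"
          then have "\<bar>D f x\<bar> \<le> L x" "\<bar>D g x\<bar> \<le> L x" "\<bar>D (p m) x\<bar> \<le> \<bar>D f x - D g x\<bar>"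
            "D (F m) x = (D f x + D g x) / 2 - D (p m) x / 2"
            using elim unfolding L2 by simp_all
          \<comment> \<open>With a = \<open>D f x\<close> and b = \<open>D g x\<close>, the sum of
            |a + b| / 2 and |a - b| / 2 is the larger of |a| and |b|.\<close>
          then show "\<bar>D (F m) x\<bar> \<le> L x"
            by (cases "D f x \<le> D g x") (auto simp: abs_le_iff field_simps)
        qed
      qed
    qed
  qed (fact L A)+
qed

text \<open>A function with oscillation at most 1 that is 1-Lipschitz for \<open>\<rho>\<close> is the infimum of the
  functions \<open>g (s n) + min 1 (\<rho> (s n) \<cdot>)\<close>, where \<open>s\<close> is a dense sequence.\<close>

lemma D_bound_small_oscillation:
  fixes \<rho> :: "'a \<Rightarrow> 'a \<Rightarrow> real" and s :: "nat \<Rightarrow> 'a"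
  assumes dense: "\<And>y e. 0 < e \<Longrightarrow> \<exists>n. dist (s n) y < e"
    and \<rho>_le: "\<And>x y. \<rho> x y \<le> K * dist x y" and \<rho>_nonneg: "\<And>x y. 0 \<le> \<rho> x y"
    and \<rho>_commute: "\<And>x y. \<rho> x y = \<rho> y x"
    and \<rho>_triangle: "\<And>x y z. \<rho> x z \<le> \<rho> x y + \<rho> y z"
    and L: "L \<in> borel_measurable \<mu>" and A: "A \<in> sets \<mu>"
    and D_le: "\<And>n. AE x in \<mu>. x \<in> A \<longrightarrow> \<bar>D (\<lambda>y. min 1 (\<rho> (s n) y)) x\<bar> \<le> L x"
    and g_bdd: "\<And>x. \<bar>g x\<bar> \<le> B" and g_lip: "\<And>x y. \<bar>g x - g y\<bar> \<le> \<rho> x y"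
    and g_osc: "\<And>x y. \<bar>g x - g y\<bar> \<le> 1"
  shows "AE x in \<mu>. x \<in> A \<longrightarrow> \<bar>D g x\<bar> \<le> L x"
proof -
  define f where "f n x = g (s n) + min 1 (\<rho> (s n) x)" for n x
  have K: "0 \<le> K \<or> (\<forall>x y::'a. x = y)"
    using order_trans[OF \<rho>_nonneg \<rho>_le] by (metis zero_le_dist dist_eq_0_iff zero_le_mult_iff order_antisym)
  have lip1: "lip_bdd (max 1 K) (\<lambda>y. min 1 (\<rho> (s n) y))" for n
  proof (rule lip_bddI)
    show "\<bar>min 1 (\<rho> (s n) x)\<bar> \<le> max 1 K" for x
      using \<rho>_nonneg[of "s n" x] by simp
    show "\<bar>min 1 (\<rho> (s n) x) - min 1 (\<rho> (s n) y)\<bar> \<le> max 1 K * dist x y" for x y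
    proof -
      have "\<bar>min 1 (\<rho> (s n) x) - min 1 (\<rho> (s n) y)\<bar> \<le> \<rho> x y"
        using \<rho>_triangle[of "s n" x y] \<rho>_triangle[of "s n" y x] \<rho>_commute[of x y] \<rho>_nonneg[of x y]
        by linarith
      also have "\<dots> \<le> max 1 K * dist x y"
        by (rule order_trans[OF \<rho>_le]) (simp add: mult_right_mono)
      finally show ?thesis .
    qed
  qed
  have f_lip: "lip_bdd (B + max 1 K) (f n)" for n
    unfolding f_def by (intro lip_bdd_add lip_bdd_const g_bdd lip1)
  have f_D: "AE x in \<mu>. x \<in> A \<longrightarrow> \<bar>D (f n) x\<bar> \<le> L x" for n
  proof -
    have "AE x in \<mu>. D (f n) x = D (\<lambda>y. g (s n)) x + D (\<lambda>y. min 1 (\<rho> (s n) y)) x"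
      unfolding f_def by (intro D_add Lip_b_const Lip_bI[OF lip1])
    with D_const[of "g (s n)"] D_le[of n] show ?thesis
      by eventually_elim auto
  qed
  \<comment> \<open>\<open>G m\<close> is the minimum of \<open>f 0\<close>, ...,
    \<open>f m\<close>, so \<open>D_bound_min\<close> applies inductively.\<close>
  define G where "G = rec_nat (f 0) (\<lambda>m G x. min (G x) (f (Suc m) x))"
  have G_0: "G 0 = f 0" and G_Suc: "G (Suc m) = (\<lambda>x. min (G m x) (f (Suc m) x))" for m
    by (simp_all add: G_def)
  have G_lip: "lip_bdd (B + max 1 K) (G m)" for m
    by (induction m) (auto simp: G_0 G_Suc intro: f_lip lip_bdd_min)
  \<comment> \<open>The truncation at 1 is harmless because \<open>g\<close> oscillates by at most
    1: both \<open>g (s n) + 1\<close> and \<open>g (s n) + \<rho> (s n) x\<close> are at least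
    \<open>g x\<close>.\<close>
  have f_ge: "g x \<le> f n x" for n x
    using g_osc[of x "s n"] g_lip[of x "s n"] \<rho>_commute[of x "s n"] by (auto simp: f_def)
  have G_ge: "g x \<le> G m x" for m x
    by (induction m) (auto simp: G_0 G_Suc f_ge)
  have G_le: "n \<le> m \<Longrightarrow> G m x \<le> f n x" for n m x
    by (induction m) (auto simp: G_0 G_Suc le_Suc_eq min.coboundedI1)
  show ?thesis
  proof (rule D_bound_closed[OF G_lip _ L A])
    show "(\<lambda>m. G m x) \<longlonglongrightarrow> g x" for x
    proof (rule LIMSEQ_I)
      fix e :: real assume "0 < e"
      \<comment> \<open>Both \<open>g (s n) - g x\<close> and the truncated distance are at most
        \<open>\<rho> (s n) x\<close>, which this choice makes smaller than e / 2.\<close>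
      then obtain n where n: "dist (s n) x < e / (2 * max 1 K)"
        using dense[of "e / (2 * max 1 K)" x] by auto
      have "\<rho> (s n) x \<le> max 1 K * dist (s n) x"
        by (rule order_trans[OF \<rho>_le]) (simp add: mult_right_mono)
      also have "\<dots> < e / 2"
        using n by (simp add: field_simps)
      finally have "f n x < g x + e"
        using g_lip[of "s n" x] unfolding f_def by linarith
      then have "norm (G m x - g x) < e" if "n \<le> m" for m
        using G_le[OF that, of x] G_ge[of x m] by simp
      then show "\<exists>N. \<forall>m\<ge>N. norm (G m x - g x) < e" by auto
    qed
    show "AE x in \<mu>. x \<in> A \<longrightarrow> \<bar>D (G m) x\<bar> \<le> L x" for m
    proof (induction m)
      case 0
      show ?case unfolding G_0 by (rule f_D)
    next
      case (Suc m)
      show ?case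
        unfolding G_Suc by (rule D_bound_min[OF Lip_bI[OF G_lip] Lip_bI[OF f_lip] L A Suc f_D])
    qed
  qed
qed

text \<open>The values of \<open>g\<close> are truncated to intervals of length 1, which makes the
  oscillation small. By locality, the bound for a truncation holds for \<open>g\<close> wherever its
  value is interior to the interval, and the interiors of half-overlapping intervals cover the
  line.\<close>

lemma D_bound_lipschitz:
  fixes \<rho> :: "'a \<Rightarrow> 'a \<Rightarrow> real" and s :: "nat \<Rightarrow> 'a"
  assumes dense: "\<And>y e. 0 < e \<Longrightarrow> \<exists>n. dist (s n) y < e"
    and \<rho>_le: "\<And>x y. \<rho> x y \<le> K * dist x y" and \<rho>_nonneg: "\<And>x y. 0 \<le> \<rho> x y"
    and \<rho>_commute: "\<And>x y. \<rho> x y = \<rho> y x"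
    and \<rho>_triangle: "\<And>x y z. \<rho> x z \<le> \<rho> x y + \<rho> y z"
    and L: "L \<in> borel_measurable \<mu>" and A: "A \<in> sets \<mu>"
    and D_le: "\<And>n. AE x in \<mu>. x \<in> A \<longrightarrow> \<bar>D (\<lambda>y. min 1 (\<rho> (s n) y)) x\<bar> \<le> L x"
    and g: "g \<in> Lip_b" and g_lip: "\<And>x y. \<bar>g x - g y\<bar> \<le> \<rho> x y"
  shows "AE x in \<mu>. x \<in> A \<longrightarrow> \<bar>D g x\<bar> \<le> L x"
proof -
  \<comment> \<open>\<open>c i\<close> clamps to the interval from i / 2 to i / 2 + 1, and
    \<open>e i\<close> is a tent function that is positive exactly on its interior.\<close>
  define c where "c i t = max (real_of_int i / 2) (min (real_of_int i / 2 + 1) t)" for i :: int and t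
  define e where "e i t = max 0 (min (t - real_of_int i / 2) (real_of_int i / 2 + 1 - t))"
    for i :: int and t
  have c_lip: "\<bar>c i t - c i u\<bar> \<le> \<bar>t - u\<bar>" and e_lip: "\<bar>e i t - e i u\<bar> \<le> \<bar>t - u\<bar>" for i t u
    by (auto simp: c_def e_def)
  have c: "(\<lambda>x. c i (g x)) \<in> Lip_b" and e: "(\<lambda>x. e i (g x)) \<in> Lip_b" for i
    using c_lip e_lip by (auto intro: Lip_b_comp[OF g])
  have "AE x in \<mu>. x \<in> A \<longrightarrow> \<bar>D (\<lambda>x. c i (g x)) x\<bar> \<le> L x" for i
  proof (rule D_bound_small_oscillation[OF dense \<rho>_le \<rho>_nonneg \<rho>_commute \<rho>_triangle L A D_le])
    show "\<bar>c i (g x)\<bar> \<le> \<bar>real_of_int i / 2\<bar> + 1" for x by (auto simp: c_def)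
    show "\<bar>c i (g x) - c i (g y)\<bar> \<le> \<rho> x y" for x y
      using c_lip g_lip by (rule order_trans)
    show "\<bar>c i (g x) - c i (g y)\<bar> \<le> 1" for x y by (auto simp: c_def)
  qed
  \<comment> \<open>Where the tent is nonzero the clamp changes nothing, so the tent times
    \<open>g x - c i (g x)\<close> is 0 everywhere.\<close>
  moreover have "AE x in \<mu>. e i (g x) \<noteq> 0 \<longrightarrow> D (\<lambda>x. g x - c i (g x)) x = 0" for i
    by (rule D_local[OF e Lip_b_diff[OF g c]]) (auto simp: e_def c_def)
  moreover have "AE x in \<mu>. D (\<lambda>x. g x - c i (g x)) x = D g x - D (\<lambda>x. c i (g x)) x" for i
    by (rule D_diff[OF g c])
  ultimately have "AE x in \<mu>. \<forall>i. (x \<in> A \<longrightarrow> \<bar>D (\<lambda>x. c i (g x)) x\<bar> \<le> L x) \<and>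
      (e i (g x) \<noteq> 0 \<longrightarrow> D (\<lambda>x. g x - c i (g x)) x = 0) \<and>
      D (\<lambda>x. g x - c i (g x)) x = D g x - D (\<lambda>x. c i (g x)) x"
    by (simp add: AE_all_countable)
  then show ?thesis
  proof eventually_elim
    case (elim x)
    \<comment> \<open>This index satisfies i < 2 g(x) \<le> i + 1, which places \<open>g x\<close>
      in the interior of the interval with index i.\<close>
    define i where "i = \<lceil>2 * g x\<rceil> - 1"
    have "real_of_int i < 2 * g x"
      unfolding i_def by linarith
    moreover have "2 * g x < real_of_int i + 2"
      unfolding i_def by linarith
    ultimately have "e i (g x) \<noteq> 0"
      by (simp add: e_def)
    with elim show ?case by (metis diff_eq_diff_eq eq_iff_diff_eq_0)
  qed
qed

end

section \<open>From weak* continuous derivations to \<open>weak_derivation\<close>\<close>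

lemma limitin_topology_generated_by:
  assumes "l \<in> topspace (topology_generated_by S)"
    and "\<And>U. U \<in> S \<Longrightarrow> l \<in> U \<Longrightarrow> \<forall>\<^sub>F m in net. F m \<in> U"
  shows "limitin (topology_generated_by S) F l net"
proof -
  have "\<forall>\<^sub>F m in net. F m \<in> U" if "generate_topology_on S U" "l \<in> U" for U
    using that
  proof (induction rule: generate_topology_on.induct)
    case (Int a b)
    then show ?case by (auto intro: eventually_conj)
  next
    case (UN K)
    then obtain k where "k \<in> K" "l \<in> k" "\<forall>\<^sub>F m in net. F m \<in> k" by blast
    then show ?case by (auto elim: eventually_mono)
  qed (use assms in auto)
  with assms(1) show ?thesis
    by (auto simp: limitin_def openin_topology_generated_by_iff)
qed

text \<open>Uniformly on a ball of \<open>Lip_b\<close>, a predual functional is close to a finite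
  combination of point evaluations, and such a combination converges along the sequence.\<close>

lemma tendsto_Lip_b_predual:
  assumes \<phi>: "\<phi> \<in> Lip_b_predual"
    and F: "\<And>m. lip_bdd K (F m)" and f: "lip_bdd K f" and lim: "\<And>x. (\<lambda>m. F m x) \<longlonglongrightarrow> f x"
  shows "(\<lambda>m. \<phi> (F m)) \<longlonglongrightarrow> \<phi> f"
proof (rule LIMSEQ_I)
  fix e :: real assume e: "0 < e"
  have K: "0 \<le> K" using f by (rule lip_bdd_nonneg)
  \<comment> \<open>The summand 1 keeps the denominator positive when K = 0.\<close>
  define d where "d = e / (3 * (K + 1))"
  have d: "0 < d" "d * K < e / 3"
    using e K by (auto simp: d_def field_simps)
  obtain S c where S: "\<And>g. g \<in> Lip_b \<Longrightarrow> \<bar>\<phi> g - (\<Sum>x\<in>S. c x * g x)\<bar> \<le> d * Lip_b_norm g"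
    using \<phi> d(1) unfolding Lip_b_predual_def by blast
  have approx: "\<bar>\<phi> g - (\<Sum>x\<in>S. c x * g x)\<bar> < e / 3" if "lip_bdd K g" for g
  proof -
    have "\<bar>\<phi> g - (\<Sum>x\<in>S. c x * g x)\<bar> \<le> d * Lip_b_norm g"
      by (rule S[OF Lip_bI[OF that]])
    also have "\<dots> \<le> d * K"
      using Lip_b_norm_le[OF that] d(1) by (intro mult_left_mono) auto
    finally show ?thesis using d(2) by linarith
  qed
  have "(\<lambda>m. \<Sum>x\<in>S. c x * F m x) \<longlonglongrightarrow> (\<Sum>x\<in>S. c x * f x)"
    by (intro tendsto_intros lim)
  then have "\<exists>N. \<forall>m\<ge>N. norm ((\<Sum>x\<in>S. c x * F m x) - (\<Sum>x\<in>S. c x * f x)) < e / 3"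
    by (rule LIMSEQ_D) (use e in simp)
  then obtain N where N: "\<And>m. N \<le> m \<Longrightarrow> \<bar>(\<Sum>x\<in>S. c x * F m x) - (\<Sum>x\<in>S. c x * f x)\<bar> < e / 3"
    unfolding real_norm_def by blast
  have "norm (\<phi> (F m) - \<phi> f) < e" if "N \<le> m" for m
    using approx[OF F, of m] approx[OF f] N[OF that] unfolding real_norm_def by linarith
  then show "\<exists>N. \<forall>m\<ge>N. norm (\<phi> (F m) - \<phi> f) < e" by blast
qed

lemma limitin_weak_star_Lip_b:
  assumes F: "\<And>m. lip_bdd K (F m)" and f: "lip_bdd K f" and lim: "\<And>x. (\<lambda>m. F m x) \<longlonglongrightarrow> f x"
  shows "limitin weak_star_Lip_b F f sequentially"
  unfolding weak_star_Lip_b_def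
proof (rule limitin_topology_generated_by)
  \<comment> \<open>The zero functional shows that all of \<open>Lip_b\<close> is a subbasic set, so
    \<open>f\<close> is a point of the generated space.\<close>
  have "(\<lambda>_. 0) \<in> (Lip_b_predual :: (('a \<Rightarrow> real) \<Rightarrow> real) set)"
    unfolding Lip_b_predual_def
    by (auto intro!: exI[of _ "{}"] simp: Lip_b_norm_nonneg)
  then have "{g \<in> (Lip_b :: ('a \<Rightarrow> real) set). (\<lambda>_. 0) g \<in> (UNIV :: real set)}
      \<in> {{f \<in> Lip_b. \<phi> f \<in> W} |\<phi> W. \<phi> \<in> Lip_b_predual \<and> open W}"
    by (intro CollectI exI[of _ "\<lambda>_. 0"] exI[of _ UNIV] conjI) auto
  then show "f \<in> topspace (topology_generated_by {{f \<in> Lip_b. \<phi> f \<in> W} |\<phi> W. \<phi> \<in> Lip_b_predual \<and> open W})"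
    unfolding topology_generated_by_topspace by (rule UnionI) (simp add: Lip_bI[OF f])
next
  fix U assume "U \<in> {{f \<in> Lip_b. \<phi> f \<in> W} |\<phi> W. \<phi> \<in> Lip_b_predual \<and> open W}" "f \<in> U"
  then obtain \<phi> W where U: "U = {f \<in> Lip_b. \<phi> f \<in> W}" "\<phi> \<in> Lip_b_predual" "open W" "\<phi> f \<in> W"
    by auto
  have "\<forall>\<^sub>F m in sequentially. \<phi> (F m) \<in> W"
    using tendsto_Lip_b_predual[OF U(2) F f lim] U(3,4) by (rule topological_tendstoD)
  then show "\<forall>\<^sub>F m in sequentially. F m \<in> U"
    by eventually_elim (use U(1) Lip_bI[OF F] in auto)
qed

text \<open>Every point has an open neighbourhood of finite measure, and the Lindelof property
  extracts a countable cover from these.\<close>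

lemma radon_measure_sigma_finite:
  assumes "radon_measure \<mu>"
  shows "sigma_finite_measure \<mu>"
proof
  have sets: "sets \<mu> = sets borel" and "\<forall>x. \<exists>W. open W \<and> x \<in> W \<and> emeasure \<mu> W < \<infinity>"
    using assms by (auto simp: radon_measure_def)
  then obtain W where W: "\<And>x. open (W x)" "\<And>x. x \<in> W x" "\<And>x. emeasure \<mu> (W x) < \<infinity>"
    by metis
  obtain C where C: "C \<subseteq> range W" "countable C" "\<Union>C = \<Union>(range W)"
    by (rule Lindelof[of "range W"]) (use W(1) in auto)
  show "\<exists>A. countable A \<and> A \<subseteq> sets \<mu> \<and> \<Union>A = space \<mu> \<and> (\<forall>a\<in>A. emeasure \<mu> a \<noteq> \<infinity>)"
  proof (intro exI[of _ C] conjI ballI)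
    show "C \<subseteq> sets \<mu>" using C(1) W(1) by (auto simp: sets)
    show "\<Union>C = space \<mu>"
      using C(3) W(2) sets_eq_imp_space_eq[OF sets] by auto
    show "emeasure \<mu> a \<noteq> \<infinity>" if "a \<in> C" for a
      using that C(1) W(3) by (auto simp: less_top)
  qed fact
qed

text \<open>Convergence of the integrals against a fixed \<open>u\<close> is read off from the
  subbasic open sets that \<open>u\<close> defines in \<open>weak_star_Linf \<mu>\<close>.\<close>

lemma derivation_imp_weak_derivation:
  assumes \<mu>: "radon_measure \<mu>" and D: "derivation \<mu> D"
  shows "weak_derivation \<mu> D"
proof (intro weak_derivation.intro weak_derivation_axioms.intro radon_measure_sigma_finite[OF \<mu>])
  show "sets \<mu> = sets borel" using \<mu> by (simp add: radon_measure_def)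
next
  fix K and F :: "nat \<Rightarrow> 'a \<Rightarrow> real" and f u :: "'a \<Rightarrow> real"
  assume F: "\<And>m. lip_bdd K (F m)" and lim: "\<And>x. (\<lambda>m. F m x) \<longlonglongrightarrow> f x" and u: "integrable \<mu> u"
  have f: "lip_bdd K f"
    by (rule lip_bdd_limit[OF F lim])
  have "limitin (weak_star_Linf \<mu>) (D \<circ> F) (D f) sequentially"
    using D limitin_weak_star_Lip_b[OF F f lim]
    by (intro continuous_map_limit[of weak_star_Lip_b]) (auto simp: derivation_def)
  then have ev: "openin (weak_star_Linf \<mu>) U \<Longrightarrow> D f \<in> U \<Longrightarrow> \<forall>\<^sub>F m in sequentially. D (F m) \<in> U" for U
    by (auto simp: limitin_def)
  show "(\<lambda>m. \<integral>x. D (F m) x * u x \<partial>\<mu>) \<longlonglongrightarrow> (\<integral>x. D f x * u x \<partial>\<mu>)"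
  proof (rule topological_tendstoI)
    fix W :: "real set" assume "open W" "(\<integral>x. D f x * u x \<partial>\<mu>) \<in> W"
    moreover from this u have "openin (weak_star_Linf \<mu>) {h \<in> Linf \<mu>. (\<integral>x. h x * u x \<partial>\<mu>) \<in> W}"
      unfolding weak_star_Linf_def by (intro topology_generated_by_Basis) blast
    moreover have "D f \<in> Linf \<mu>"
      using D Lip_bI[OF f] by (auto simp: derivation_def)
    ultimately have "\<forall>\<^sub>F m in sequentially. D (F m) \<in> {h \<in> Linf \<mu>. (\<integral>x. h x * u x \<partial>\<mu>) \<in> W}"
      by (intro ev) auto
    then show "\<forall>\<^sub>F m in sequentially. (\<integral>x. D (F m) x * u x \<partial>\<mu>) \<in> W"
      by eventually_elim auto
  qed
qed (use D in \<open>auto simp: derivation_def\<close>)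

text \<open>The bound is uniform over the unit ball, which contains all functions
  \<open>coord j\<close>. It will supply the level at which their derivatives are truncated.\<close>

lemma derivation_bounded:
  assumes "derivation \<mu> D"
  obtains B where "\<And>f. lip_bdd 1 f \<Longrightarrow> AE x in \<mu>. \<bar>D f x\<bar> \<le> B"
proof -
  from assms obtain C where C: "\<And>f. f \<in> Lip_b \<Longrightarrow> Linf_norm \<mu> (D f) \<le> C * Lip_b_norm f"
    unfolding derivation_def by blast
  \<comment> \<open>The extra 1 makes the inequality for the infimum strict, so that some admissible
    constant lies below \<open>\<bar>C\<bar> + 1\<close>.\<close>
  have "AE x in \<mu>. \<bar>D f x\<bar> \<le> \<bar>C\<bar> + 1" if f: "lip_bdd 1 f" for f
  proof -
    have "Linf_norm \<mu> (D f) \<le> C * Lip_b_norm f"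
      by (rule C[OF Lip_bI[OF f]])
    also have "\<dots> \<le> \<bar>C\<bar> * 1"
      using Lip_b_norm_le[OF f] Lip_b_norm_nonneg[OF Lip_bI[OF f]] by (intro mult_mono) auto
    finally have lt: "Linf_norm \<mu> (D f) < \<bar>C\<bar> + 1" by simp
    have "D f \<in> Linf \<mu>"
      using assms Lip_bI[OF f] by (auto simp: derivation_def)
    then obtain b where b: "AE x in \<mu>. \<bar>D f x\<bar> \<le> b" by (auto simp: Linf_def)
    have "AE x in \<mu>. \<bar>D f x\<bar> \<le> max 0 b"
      using b by eventually_elim auto
    then have "{c. 0 \<le> c \<and> (AE x in \<mu>. \<bar>D f x\<bar> \<le> c)} \<noteq> {}"
      by (auto intro!: exI[of _ "max 0 b"])
    from cInf_lessD[OF this lt[unfolded Linf_norm_def]]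
    obtain c where "AE x in \<mu>. \<bar>D f x\<bar> \<le> c" "c < \<bar>C\<bar> + 1" by auto
    then show ?thesis by (auto elim: eventually_mono)
  qed
  then show thesis by (rule that)
qed

text \<open>For continuity, the coefficients are moved onto the test function:
  \<open>h\<^sub>1 x * u x\<close> and \<open>h\<^sub>2 x * u x\<close> are again
  integrable.\<close>

lemma weak_derivation_combination:
  assumes 1: "weak_derivation \<mu> D\<^sub>1" and 2: "weak_derivation \<mu> D\<^sub>2"
    and h: "h\<^sub>1 \<in> Linf \<mu>" "h\<^sub>2 \<in> Linf \<mu>"
  shows "weak_derivation \<mu> (\<lambda>f x. h\<^sub>1 x * D\<^sub>1 f x + h\<^sub>2 x * D\<^sub>2 f x)"
proof -
  interpret D1: weak_derivation \<mu> D\<^sub>1 by (rule 1)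
  interpret D2: weak_derivation \<mu> D\<^sub>2 by (rule 2)
  show ?thesis
  proof
    show "sets \<mu> = sets borel" by (rule D1.sets_borel)
    show "(\<lambda>x. h\<^sub>1 x * D\<^sub>1 f x + h\<^sub>2 x * D\<^sub>2 f x) \<in> Linf \<mu>" if "f \<in> Lip_b" for f
      using that by (intro Linf_add Linf_mult h D1.D_Linf D2.D_Linf)
  next
    fix f g :: "'a \<Rightarrow> real" and a b :: real assume fg: "f \<in> Lip_b" "g \<in> Lip_b"
    show "AE x in \<mu>. h\<^sub>1 x * D\<^sub>1 (\<lambda>y. a * f y + b * g y) x + h\<^sub>2 x * D\<^sub>2 (\<lambda>y. a * f y + b * g y) x
        = a * (h\<^sub>1 x * D\<^sub>1 f x + h\<^sub>2 x * D\<^sub>2 f x) + b * (h\<^sub>1 x * D\<^sub>1 g x + h\<^sub>2 x * D\<^sub>2 g x)"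
      using D1.D_linear[OF fg, of a b] D2.D_linear[OF fg, of a b]
      by eventually_elim (simp add: algebra_simps)
    show "AE x in \<mu>. h\<^sub>1 x * D\<^sub>1 (\<lambda>y. f y * g y) x + h\<^sub>2 x * D\<^sub>2 (\<lambda>y. f y * g y) x
        = f x * (h\<^sub>1 x * D\<^sub>1 g x + h\<^sub>2 x * D\<^sub>2 g x) + g x * (h\<^sub>1 x * D\<^sub>1 f x + h\<^sub>2 x * D\<^sub>2 f x)"
      using D1.D_leibniz[OF fg] D2.D_leibniz[OF fg]
      by eventually_elim (simp add: algebra_simps)
  next
    fix K and F :: "nat \<Rightarrow> 'a \<Rightarrow> real" and f u :: "'a \<Rightarrow> real"
    assume F: "\<And>m. lip_bdd K (F m)" and lim: "\<And>x. (\<lambda>m. F m x) \<longlonglongrightarrow> f x" and u: "integrable \<mu> u"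
    have hu: "integrable \<mu> (\<lambda>x. h\<^sub>1 x * u x)" "integrable \<mu> (\<lambda>x. h\<^sub>2 x * u x)"
      using h u by (auto intro: integrable_Linf_mult)
    have eq: "(\<integral>x. (h\<^sub>1 x * D\<^sub>1 g x + h\<^sub>2 x * D\<^sub>2 g x) * u x \<partial>\<mu>)
        = (\<integral>x. D\<^sub>1 g x * (h\<^sub>1 x * u x) \<partial>\<mu>) + (\<integral>x. D\<^sub>2 g x * (h\<^sub>2 x * u x) \<partial>\<mu>)"
      if "lip_bdd K g" for g
    proof (subst Bochner_Integration.integral_add[symmetric])
      show "integrable \<mu> (\<lambda>x. D\<^sub>1 g x * (h\<^sub>1 x * u x))" "integrable \<mu> (\<lambda>x. D\<^sub>2 g x * (h\<^sub>2 x * u x))"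
        using Lip_bI[OF that] by (auto intro!: integrable_Linf_mult hu D1.D_Linf D2.D_Linf)
    qed (simp add: algebra_simps)
    show "(\<lambda>m. \<integral>x. (h\<^sub>1 x * D\<^sub>1 (F m) x + h\<^sub>2 x * D\<^sub>2 (F m) x) * u x \<partial>\<mu>)
        \<longlonglongrightarrow> (\<integral>x. (h\<^sub>1 x * D\<^sub>1 f x + h\<^sub>2 x * D\<^sub>2 f x) * u x \<partial>\<mu>)"
      unfolding eq[OF F] eq[OF lip_bdd_limit[OF F lim]]
      by (intro tendsto_add D1.D_weak_continuous[OF F lim] D2.D_weak_continuous[OF F lim] hu)
  qed
qed

subsection \<open>The perturbed metric\<close>

definition dense_seq :: "nat \<Rightarrow> 'a::polish_space" where
  "dense_seq = (SOME s. \<forall>y e. 0 < e \<longrightarrow> (\<exists>n. dist (s n) y < e))"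

lemma dense_seq: "0 < e \<Longrightarrow> \<exists>n. dist (dense_seq n) (y :: 'a::polish_space) < e"
proof -
  obtain C :: "'a set" where C: "countable C" "\<And>X. open X \<Longrightarrow> X \<noteq> {} \<Longrightarrow> \<exists>c\<in>C. c \<in> X"
    using countable_dense_exists by metis
  have "C \<noteq> {}" using C(2)[of UNIV] by auto
  have "\<forall>y e. 0 < e \<longrightarrow> (\<exists>n. dist (from_nat_into C n) y < e)"
  proof (intro allI impI)
    fix y :: 'a and e :: real assume "0 < e"
    then obtain c where "c \<in> C" "c \<in> ball y e"
      using C(2)[of "ball y e"] by auto
    moreover obtain n where "from_nat_into C n = c"
      using from_nat_into_surj[OF C(1) \<open>c \<in> C\<close>] by blast
    ultimately show "\<exists>n. dist (from_nat_into C n) y < e"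
      by (auto simp: dist_commute)
  qed
  from someI[of "\<lambda>s. \<forall>y e. 0 < e \<longrightarrow> (\<exists>n. dist (s n) (y :: 'a) < e)", OF this]
  show "0 < e \<Longrightarrow> \<exists>n. dist (dense_seq n) y < e"
    by (auto simp: dense_seq_def)
qed

definition coord :: "nat \<Rightarrow> 'a::polish_space \<Rightarrow> real" where
  "coord j y = min 1 (dist (dense_seq j) y)"

definition embed_coord :: "nat \<Rightarrow> 'a::polish_space \<Rightarrow> real" where
  "embed_coord j y = (1/2) ^ Suc j * coord j y"

definition perturbed_dist :: "real \<Rightarrow> 'a::polish_space \<Rightarrow> 'a \<Rightarrow> real" where
  "perturbed_dist \<epsilon> x y = dist x y + \<epsilon> * l2norm (\<lambda>j. embed_coord j x - embed_coord j y)"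

lemma lip_bdd_coord: "lip_bdd 1 (coord j)"
proof (rule lip_bddI)
  show "\<bar>coord j x - coord j y\<bar> \<le> 1 * dist x y" for x y :: 'a
    using dist_triangle[of "dense_seq j" x y] dist_triangle[of "dense_seq j" y x] dist_commute[of x y]
      zero_le_dist[of x y]
    unfolding coord_def by linarith
qed (simp add: coord_def)

lemma lip_bdd_embed: "lip_bdd ((1/2) ^ Suc j) (embed_coord j)"
  using lip_bdd_cmult[OF lip_bdd_coord, of "(1/2) ^ Suc j" j] by (simp add: embed_coord_def[abs_def])

lemma Lip_b_coord: "coord j \<in> Lip_b"
  by (rule Lip_bI[OF lip_bdd_coord])

lemma Lip_b_embed: "embed_coord j \<in> Lip_b"
  by (rule Lip_bI[OF lip_bdd_embed])

lemma embed_diff: "\<bar>embed_coord j x - embed_coord j y\<bar> \<le> dist x y * (1/2) ^ Suc j"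
  using lip_bdd_diff[OF lip_bdd_embed] by (simp only: mult.commute[of "dist x y"])

lemma summable_embed_diff:
  fixes x y :: "'a::polish_space"
  shows "summable (\<lambda>j. (embed_coord j x - embed_coord j y)\<^sup>2)"
  by (rule summable_geometric_l2[OF embed_diff])

lemma l2norm_embed_diff_le: "l2norm (\<lambda>j. embed_coord j x - embed_coord j y) \<le> dist x y"
  by (rule l2norm_geometric_le[OF embed_diff])

lemma l2norm_embed_commute:
  fixes x y :: "'a::polish_space"
  shows "l2norm (\<lambda>j. embed_coord j x - embed_coord j y) = l2norm (\<lambda>j. embed_coord j y - embed_coord j x)"
  by (simp add: l2norm_def power2_commute)

lemma l2norm_embed_triangle:
  fixes x y z :: "'a::polish_space"
  shows "l2norm (\<lambda>j. embed_coord j x - embed_coord j z)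
    \<le> l2norm (\<lambda>j. embed_coord j x - embed_coord j y) + l2norm (\<lambda>j. embed_coord j y - embed_coord j z)"
  using l2norm_triangle[OF summable_embed_diff[of x y] summable_embed_diff[of y z]] by simp

context
  fixes \<epsilon> :: real assumes \<epsilon>: "0 < \<epsilon>"
begin

lemma dist_le_perturbed_dist: "dist x y \<le> perturbed_dist \<epsilon> x y"
  using \<epsilon> l2norm_nonneg[OF summable_embed_diff[of x y]] by (simp add: perturbed_dist_def)

lemma perturbed_dist_le: "perturbed_dist \<epsilon> x y \<le> (1 + \<epsilon>) * dist x y"
  using \<epsilon> l2norm_embed_diff_le[of x y] by (simp add: perturbed_dist_def distrib_right)

lemma perturbed_dist_nonneg: "0 \<le> perturbed_dist \<epsilon> x y"
  using dist_le_perturbed_dist[of x y] zero_le_dist[of x y] by linarith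

lemma perturbed_dist_commute: "perturbed_dist \<epsilon> x y = perturbed_dist \<epsilon> y x"
  by (simp add: perturbed_dist_def dist_commute l2norm_embed_commute[of x])

lemma perturbed_dist_triangle: "perturbed_dist \<epsilon> x z \<le> perturbed_dist \<epsilon> x y + perturbed_dist \<epsilon> y z"
  using dist_triangle[of x z y] mult_left_mono[OF l2norm_embed_triangle[of x z y], of \<epsilon>] \<epsilon>
  by (simp add: perturbed_dist_def distrib_left)

lemma Metric_space_perturbed_dist: "Metric_space UNIV (perturbed_dist \<epsilon>)"
proof
  show "perturbed_dist \<epsilon> x y = 0 \<longleftrightarrow> x = y" for x y :: 'a
  proof
    show "x = y" if "perturbed_dist \<epsilon> x y = 0"
      using dist_le_perturbed_dist[of x y] that by simp
    show "perturbed_dist \<epsilon> x y = 0" if "x = y"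
      using that by (simp add: perturbed_dist_def l2norm_def)
  qed
qed (rule perturbed_dist_nonneg perturbed_dist_commute perturbed_dist_triangle)+

end

subsection \<open>The local norm of the perturbed metric\<close>

text \<open>The derivatives of the coordinates are truncated at a bound \<open>B\<close> that they satisfy almost
  everywhere, so that the suprema and series below are finite at every point.\<close>

definition deriv_coord where
  "deriv_coord B D j x = max (- B) (min B (D (coord j) x :: real))"

definition sup_deriv where
  "sup_deriv B D x = (SUP j. \<bar>deriv_coord B D j x\<bar>)"

definition l2_deriv where
  "l2_deriv B D x = l2norm (\<lambda>j. (1/2) ^ Suc j * deriv_coord B D j x)"

text \<open>The denominator \<open>Suc k\<close> does not depend on w, so it is common to all
  coordinates of a vector; a real vector is thus a limit of scaled integer vectors.\<close>

lemma tendsto_floor_multiple: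
  fixes w :: real
  shows "(\<lambda>k. real_of_int \<lfloor>real (Suc k) * w\<rfloor> / real (Suc k)) \<longlonglongrightarrow> w"
proof (rule real_tendsto_sandwich)
  show "\<forall>\<^sub>F k in sequentially. w - inverse (real (Suc k)) \<le> real_of_int \<lfloor>real (Suc k) * w\<rfloor> / real (Suc k)"
  proof (intro always_eventually allI)
    fix k
    have "real (Suc k) * w - 1 \<le> real_of_int \<lfloor>real (Suc k) * w\<rfloor>" by linarith
    from divide_right_mono[OF this, of "real (Suc k)"]
    show "w - inverse (real (Suc k)) \<le> real_of_int \<lfloor>real (Suc k) * w\<rfloor> / real (Suc k)"
      by (simp add: diff_divide_distrib inverse_eq_divide del: of_nat_Suc)
  qed
  show "\<forall>\<^sub>F k in sequentially. real_of_int \<lfloor>real (Suc k) * w\<rfloor> / real (Suc k) \<le> w"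
  proof (intro always_eventually allI)
    fix k
    have "real_of_int \<lfloor>real (Suc k) * w\<rfloor> \<le> real (Suc k) * w" by linarith
    then show "real_of_int \<lfloor>real (Suc k) * w\<rfloor> / real (Suc k) \<le> w"
      by (simp add: field_simps del: of_nat_Suc)
  qed
  show "(\<lambda>k. w - inverse (real (Suc k))) \<longlonglongrightarrow> w"
    using tendsto_diff[OF tendsto_const[of w] LIMSEQ_inverse_real_of_nat] by simp
qed auto

text \<open>By homogeneity and density, the \<open>l2\<close> norm is determined by its duality with integer
  vectors, of which there are only countably many.\<close>

lemma L2_set_le_by_duality:
  fixes w :: "nat \<Rightarrow> real"
  assumes dual: "\<And>v :: int list. \<epsilon> * (\<Sum>j<length v. real_of_int (v ! j) * w j)
      \<le> T * L2_set (\<lambda>j. real_of_int (v ! j)) {..<length v}"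
    and "0 \<le> T" "0 < \<epsilon>"
  shows "\<epsilon> * L2_set w {..<m} \<le> T"
proof -
  define q where "q k j = real_of_int \<lfloor>real (Suc k) * w j\<rfloor> / real (Suc k)" for k j
  have q: "(\<lambda>k. q k j) \<longlonglongrightarrow> w j" for j
    unfolding q_def by (rule tendsto_floor_multiple)
  have "\<epsilon> * (\<Sum>j<m. q k j * w j) \<le> T * L2_set (q k) {..<m}" for k
  proof -
    \<comment> \<open>Clearing the common denominator gives an integer vector, and both sides of the
      duality bound scale by the same factor \<open>Suc k\<close>.\<close>
    define v where "v = map (\<lambda>j. \<lfloor>real (Suc k) * w j\<rfloor>) [0..<m]"
    have len: "length v = m" and nth: "j < m \<Longrightarrow> real_of_int (v ! j) = real (Suc k) * q k j" for j
      by (auto simp: v_def q_def)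
    have "real (Suc k) * (\<epsilon> * (\<Sum>j<m. q k j * w j))
        = \<epsilon> * (\<Sum>j<length v. real_of_int (v ! j) * w j)"
      by (simp add: len nth sum_distrib_left mult_ac del: of_nat_Suc)
    also have "\<dots> \<le> T * L2_set (\<lambda>j. real_of_int (v ! j)) {..<length v}"
      by (rule dual)
    also have "\<dots> = T * L2_set (\<lambda>j. real (Suc k) * q k j) {..<m}"
      unfolding len by (intro arg_cong[where f = "\<lambda>x. T * x"] L2_set_cong) (simp_all add: nth)
    also have "\<dots> = real (Suc k) * (T * L2_set (q k) {..<m})"
      by (simp add: L2_set_right_distrib del: of_nat_Suc)
    finally show ?thesis
      by (simp del: of_nat_Suc)
  qed
  \<comment> \<open>In the limit the bound is tested on \<open>w\<close> itself; one factor of its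
    norm is cancelled below.\<close>
  then have le: "\<epsilon> * (\<Sum>j<m. w j * w j) \<le> T * L2_set w {..<m}"
    unfolding L2_set_def
    by (intro LIMSEQ_le[of "\<lambda>k. \<epsilon> * (\<Sum>j<m. q k j * w j)" _ "\<lambda>k. T * sqrt (\<Sum>j<m. (q k j)\<^sup>2)"])
      (auto intro!: tendsto_intros q)
  have "(\<Sum>j<m. w j * w j) = L2_set w {..<m} * L2_set w {..<m}"
    by (simp add: L2_set_def sum_nonneg power2_eq_square)
  with le have "(\<epsilon> * L2_set w {..<m}) * L2_set w {..<m} \<le> T * L2_set w {..<m}"
    by (simp add: mult.assoc)
  then show ?thesis
    using \<open>0 \<le> T\<close> by (cases "L2_set w {..<m} = 0") (auto simp: mult_le_cancel_right order_less_le)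
qed

section \<open>Pointwise estimates for the truncated derivatives\<close>

context
  fixes B :: real assumes B: "0 \<le> B"
begin

lemma abs_deriv_coord_le: "\<bar>deriv_coord B D j x\<bar> \<le> B"
  using B by (auto simp: deriv_coord_def)

lemma deriv_coord_geometric: "\<bar>(1/2) ^ Suc j * deriv_coord B D j x\<bar> \<le> B * (1/2) ^ Suc j"
  using mult_left_mono[OF abs_deriv_coord_le[of D j x], of "(1/2) ^ Suc j"]
  by (simp add: abs_mult mult.commute del: power_Suc)

lemma summable_deriv_coord: "summable (\<lambda>j. ((1/2) ^ Suc j * deriv_coord B D j x)\<^sup>2)"
  by (rule summable_geometric_l2[OF deriv_coord_geometric])

lemma l2_deriv_le: "l2_deriv B D x \<le> B"
  unfolding l2_deriv_def by (rule l2norm_geometric_le[OF deriv_coord_geometric])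

lemma l2_deriv_nonneg: "0 \<le> l2_deriv B D x"
  unfolding l2_deriv_def by (rule l2norm_nonneg[OF summable_deriv_coord])

lemma bdd_above_deriv_coord: "bdd_above (range (\<lambda>j. \<bar>deriv_coord B D j x\<bar>))"
  by (rule bdd_aboveI[of _ B]) (auto intro: abs_deriv_coord_le)

lemma deriv_coord_le_sup: "\<bar>deriv_coord B D j x\<bar> \<le> sup_deriv B D x"
  unfolding sup_deriv_def by (rule cSUP_upper[OF UNIV_I bdd_above_deriv_coord])

lemma sup_deriv_le: "(\<And>j. \<bar>deriv_coord B D j x\<bar> \<le> t) \<Longrightarrow> sup_deriv B D x \<le> t"
  unfolding sup_deriv_def by (rule cSUP_least) auto

lemma sup_deriv_nonneg: "0 \<le> sup_deriv B D x"
  using deriv_coord_le_sup[of D 0 x] abs_ge_zero by (rule order_trans[rotated])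

lemma deriv_coord_eq_0:
  assumes "l2_deriv B D x = 0"
  shows "deriv_coord B D j x = 0"
proof -
  have "(\<Sum>j. ((1/2) ^ Suc j * deriv_coord B D j x)\<^sup>2) = 0"
    using assms l2norm_power2[OF summable_deriv_coord[of D x]] by (simp add: l2_deriv_def)
  then have "((1/2) ^ Suc j * deriv_coord B D j x)\<^sup>2 = 0"
    using suminf_eq_zero_iff[OF summable_deriv_coord[of D x]] by simp
  then show ?thesis by simp
qed

end

text \<open>\<open>B\<close> is a parameter rather than a choice depending on \<open>D\<close>, so
  that two derivations and their sum can share it. Almost everywhere the truncation at
  \<open>B\<close> is then inactive for all three.\<close>

locale bounded_weak_derivation = weak_derivation +
  fixes B :: real
  assumes B_nonneg: "0 \<le> B"
    and D_coord_bound: "\<And>j. AE x in \<mu>. \<bar>D (coord j) x\<bar> \<le> B"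
begin

lemma measurable_deriv_coord [measurable]: "deriv_coord B D j \<in> borel_measurable \<mu>"
  unfolding deriv_coord_def[abs_def] using measurable_D[OF Lip_b_coord] by measurable

lemma sup_deriv_Linf: "sup_deriv B D \<in> Linf \<mu>"
proof (rule Linf_bounded)
  show "sup_deriv B D \<in> borel_measurable \<mu>"
    unfolding sup_deriv_def[abs_def]
    by (rule borel_measurable_cSUP) (auto intro: bdd_above_deriv_coord[OF B_nonneg])
  show "\<bar>sup_deriv B D x\<bar> \<le> B" for x
    using sup_deriv_nonneg[OF B_nonneg, of D x]
      sup_deriv_le[OF B_nonneg abs_deriv_coord_le[OF B_nonneg], of D x] by simp
qed

lemma l2_deriv_Linf: "l2_deriv B D \<in> Linf \<mu>"
proof (rule Linf_bounded)
  show "l2_deriv B D \<in> borel_measurable \<mu>"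
    unfolding l2_deriv_def[abs_def] l2norm_def by measurable
  show "\<bar>l2_deriv B D x\<bar> \<le> B" for x
    using l2_deriv_nonneg[OF B_nonneg, of D x] l2_deriv_le[OF B_nonneg, of D x] by simp
qed

lemma D_coord: "AE x in \<mu>. \<forall>j. D (coord j) x = deriv_coord B D j x"
  unfolding AE_all_countable
proof
  fix j
  show "AE x in \<mu>. D (coord j) x = deriv_coord B D j x"
    using D_coord_bound[of j] by eventually_elim (auto simp: deriv_coord_def)
qed

lemma D_embed: "AE x in \<mu>. \<forall>j. D (embed_coord j) x = (1/2) ^ Suc j * deriv_coord B D j x"
  unfolding AE_all_countable
proof
  fix j
  have "AE x in \<mu>. D (embed_coord j) x = (1/2) ^ Suc j * D (coord j) x"
    unfolding embed_coord_def[abs_def] by (rule D_cmult[OF Lip_b_coord])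
  with D_coord show "AE x in \<mu>. D (embed_coord j) x = (1/2) ^ Suc j * deriv_coord B D j x"
    by eventually_elim simp
qed

text \<open>The distance of \<open>a\<close> and \<open>y\<close> in the embedding is a limit of
  regularised norms of finitely many coordinate increments. The derivative of each is bounded by a
  partial norm of the coordinate derivatives, so the final bound does not depend on
  \<open>a\<close>.\<close>

lemma D_l2norm_embed_le:
  defines "q \<equiv> \<lambda>(a :: 'a) (y :: 'a). l2norm (\<lambda>j. embed_coord j y - embed_coord j a)"
  shows "q a \<in> Lip_b" and "AE x in \<mu>. \<bar>D (q a) x\<bar> \<le> l2_deriv B D x"
proof -
  define h where "h j y = embed_coord j y - embed_coord j a" for j and y :: 'a
  have h: "h j \<in> Lip_b" for j
    unfolding h_def by (intro Lip_b_diff Lip_b_embed Lip_b_const)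
  have h_bound: "\<bar>h j y\<bar> \<le> 1 * (1/2) ^ Suc j" for j y
  proof -
    have "0 \<le> coord j y" "coord j y \<le> 1" for y :: 'a
      by (auto simp: coord_def)
    from this[of y] this[of a] have "\<bar>coord j y - coord j a\<bar> \<le> 1"
      by linarith
    then show ?thesis
      unfolding h_def embed_coord_def right_diff_distrib[symmetric] abs_mult
      by (simp add: mult_left_le del: power_Suc)
  qed
  \<comment> \<open>The regularisation is positive for each m, as \<open>D_sqrt_le\<close> requires,
    and vanishes while the number of coordinates grows.\<close>
  define F where "F m y = sqrt ((1 / real (Suc m))\<^sup>2 + (L2_set (\<lambda>j. h j y) {..<m})\<^sup>2)" for m y
  have F_lip: "lip_bdd (1 + 1) (F m)" for m
  proof -
    have "lip_bdd (\<bar>1 / real (Suc m)\<bar> + 1) (F m)"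
      unfolding F_def
    proof (rule lip_bdd_sqrt)
      show "L2_set (\<lambda>j. h j y) {..<m} \<le> 1" for y
        using L2_set_le_l2norm[OF summable_geometric_l2[OF h_bound]] l2norm_geometric_le[OF h_bound]
        by (rule order_trans)
      show "L2_set (\<lambda>j. h j x - h j y) {..<m} \<le> 1 * dist x y" for x y
        using order_trans[OF L2_set_le_l2norm[OF summable_embed_diff] l2norm_embed_diff_le, of x y m]
        by (simp add: h_def)
    qed
    then show ?thesis by (rule lip_bdd_mono) simp
  qed
  have F_lim: "(\<lambda>m. F m y) \<longlonglongrightarrow> q a y" for y
    unfolding F_def q_def
  proof (rule tendsto_sqrt_null_add)
    show "(\<lambda>m. L2_set (\<lambda>j. h j y) {..<m}) \<longlonglongrightarrow> l2norm (\<lambda>j. embed_coord j y - embed_coord j a)"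
      unfolding h_def by (rule L2_set_tendsto_l2norm[OF summable_embed_diff])
  qed (rule l2norm_nonneg[OF summable_embed_diff])
  have "AE x in \<mu>. x \<in> space \<mu> \<longrightarrow> \<bar>D (q a) x\<bar> \<le> l2_deriv B D x"
  proof (rule D_bound_closed[OF F_lip F_lim])
    show "AE x in \<mu>. x \<in> space \<mu> \<longrightarrow> \<bar>D (F m) x\<bar> \<le> l2_deriv B D x" for m
    proof -
      have "AE x in \<mu>. \<bar>D (F m) x\<bar> \<le> L2_set (\<lambda>j. D (h j) x) {..<m}"
        unfolding F_def by (rule D_sqrt_le[OF _ h]) simp
      moreover have "AE x in \<mu>. \<forall>j. D (h j) x = D (embed_coord j) x - D (\<lambda>y. embed_coord j a) x"
        unfolding AE_all_countable h_def by (intro allI D_diff Lip_b_embed Lip_b_const)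
      moreover have "AE x in \<mu>. \<forall>j. D (\<lambda>y. embed_coord j a) x = 0"
        unfolding AE_all_countable by (intro allI D_const)
      ultimately show ?thesis
        using D_embed
      proof eventually_elim
        case (elim x)
        have "D (h j) x = (1/2) ^ Suc j * deriv_coord B D j x" for j
          using elim(2-4) by (metis diff_zero)
        then have "L2_set (\<lambda>j. D (h j) x) {..<m} = L2_set (\<lambda>j. (1/2) ^ Suc j * deriv_coord B D j x) {..<m}"
          by (simp only:)
        also have "\<dots> \<le> l2_deriv B D x"
          unfolding l2_deriv_def by (rule L2_set_le_l2norm[OF summable_deriv_coord[OF B_nonneg]])
        finally show ?case using elim(1) by (auto intro: order_trans)
      qed
    qed
  qed (use l2_deriv_Linf in \<open>auto dest: Linf_measurable\<close>)
  then show "AE x in \<mu>. \<bar>D (q a) x\<bar> \<le> l2_deriv B D x"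
    using AE_space by eventually_elim simp
  show "q a \<in> Lip_b"
    by (rule Lip_bI[OF lip_bdd_limit[OF F_lip F_lim]])
qed

section \<open>Identification of the local norm\<close>

context
  fixes \<epsilon> :: real assumes \<epsilon>: "0 < \<epsilon>"
begin

text \<open>By \<open>D_bound_lipschitz\<close> it is enough to treat truncated perturbed distances
  to the points of the dense sequence. The \<open>dist\<close> part contributes at most
  \<open>sup_deriv\<close>, the embedded part at most \<open>\<epsilon> * l2_deriv\<close>.\<close>

lemma D_le_perturbed:
  assumes g: "g \<in> Lip_b" and g_lip: "\<And>x y. \<bar>g x - g y\<bar> \<le> perturbed_dist \<epsilon> x y"
  shows "AE x in \<mu>. \<bar>D g x\<bar> \<le> sup_deriv B D x + \<epsilon> * l2_deriv B D x"
proof -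
  let ?L = "\<lambda>x. sup_deriv B D x + \<epsilon> * l2_deriv B D x"
  have L: "?L \<in> borel_measurable \<mu>"
    using sup_deriv_Linf l2_deriv_Linf by (auto dest!: Linf_measurable)
  have "AE x in \<mu>. x \<in> space \<mu> \<longrightarrow> \<bar>D g x\<bar> \<le> ?L x"
  proof (rule D_bound_lipschitz[OF dense_seq perturbed_dist_le[OF \<epsilon>] perturbed_dist_nonneg[OF \<epsilon>]
        perturbed_dist_commute[OF \<epsilon>] perturbed_dist_triangle[OF \<epsilon>] L sets.top _ g g_lip])
    fix n
    define q where "q y = l2norm (\<lambda>j. embed_coord j y - embed_coord j (dense_seq n :: 'a))" for y :: 'a
    have q: "q \<in> Lip_b" and Dq: "AE x in \<mu>. \<bar>D q x\<bar> \<le> l2_deriv B D x"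
      using D_l2norm_embed_le[of "dense_seq n"] by (simp_all add: q_def[abs_def])
    have q_nonneg: "0 \<le> \<epsilon> * q y" for y
      unfolding q_def using \<epsilon> by (intro mult_nonneg_nonneg l2norm_nonneg summable_embed_diff) auto
    \<comment> \<open>Since the second summand is nonnegative, truncating the first one at 1
      beforehand does not change the minimum with 1.\<close>
    have eq: "(\<lambda>y. min 1 (perturbed_dist \<epsilon> (dense_seq n) y)) = (\<lambda>y. min 1 (1 * coord n y + \<epsilon> * q y))"
    proof
      fix y :: 'a
      show "min 1 (perturbed_dist \<epsilon> (dense_seq n) y) = min 1 (1 * coord n y + \<epsilon> * q y)"
        using q_nonneg[of y] unfolding perturbed_dist_def coord_def q_def l2norm_embed_commute[of y]
        by linarith
    qed
    have "AE x in \<mu>. \<bar>D (\<lambda>y. 1 * coord n y + \<epsilon> * q y) x\<bar> \<le> ?L x"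
      using D_linear[OF Lip_b_coord[of n] q, of 1 \<epsilon>] D_coord Dq
    proof eventually_elim
      case (elim x)
      have "\<bar>D (\<lambda>y. 1 * coord n y + \<epsilon> * q y) x\<bar> \<le> \<bar>deriv_coord B D n x\<bar> + \<epsilon> * \<bar>D q x\<bar>"
        using elim \<epsilon> abs_triangle_ineq[of "deriv_coord B D n x" "\<epsilon> * D q x"] by (simp add: abs_mult)
      also have "\<dots> \<le> ?L x"
        using elim \<epsilon> by (intro add_mono mult_left_mono deriv_coord_le_sup B_nonneg) auto
      finally show ?case .
    qed
    moreover have "AE x in \<mu>. \<bar>D (\<lambda>y. 1) x\<bar> \<le> ?L x"
      using D_const[of 1] \<epsilon> sup_deriv_nonneg[OF B_nonneg, of D] l2_deriv_nonneg[OF B_nonneg, of D]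
      by (auto intro: add_nonneg_nonneg)
    ultimately show "AE x in \<mu>. x \<in> space \<mu> \<longrightarrow>
        \<bar>D (\<lambda>y. min 1 (perturbed_dist \<epsilon> (dense_seq n) y)) x\<bar> \<le> ?L x"
      unfolding eq
      by (intro D_bound_min L Lip_b_const Lip_b_add Lip_b_cmult Lip_b_coord q)
        (auto elim: eventually_mono)
  qed
  then show ?thesis using AE_space by eventually_elim simp
qed

text \<open>The test functions are indexed by an integer s with |s| at most 1, a coordinate and an
  integer vector. These are countably many, so outside one null set the best index may be chosen
  separately at each point.\<close>

lemma perturbed_le_local_norm_bound:
  assumes l: "local_norm_bound \<mu> (perturbed_dist \<epsilon>) D l"
  shows "AE x in \<mu>. sup_deriv B D x + \<epsilon> * l2_deriv B D x \<le> l x"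
proof -
  \<comment> \<open>\<open>e v\<close> pairs the embedding with \<open>v\<close>, and division by
    the norm \<open>N v\<close> turns \<open>v\<close> into a unit vector. For
    \<open>N v = 0\<close> the quotient \<open>\<epsilon> / N v\<close> is 0, and only the
    coordinate term of \<open>g\<close> remains.\<close>
  define N where "N v = L2_set (\<lambda>j. real_of_int (v ! j)) {..<length v}" for v
  define e where "e v y = (\<Sum>j<length v. real_of_int (v ! j) * embed_coord j y)" for v and y :: 'a
  define g where "g s n v y = real_of_int s * coord n y + \<epsilon> / N v * e v y" for s :: int and n v and y :: 'a
  have e: "e v \<in> Lip_b" for v
    unfolding e_def by (intro Lip_b_sum Lip_b_cmult Lip_b_embed)
  have e_diff: "\<bar>e v x - e v y\<bar> \<le> N v * l2norm (\<lambda>j. embed_coord j x - embed_coord j y)" for v x y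
  proof -
    have "\<bar>e v x - e v y\<bar> \<le> (\<Sum>j<length v. \<bar>real_of_int (v ! j)\<bar> * \<bar>embed_coord j x - embed_coord j y\<bar>)"
      unfolding e_def sum_subtractf[symmetric] right_diff_distrib[symmetric] abs_mult[symmetric]
      by (rule sum_abs)
    also have "\<dots> \<le> N v * L2_set (\<lambda>j. embed_coord j x - embed_coord j y) {..<length v}"
      unfolding N_def by (rule L2_set_mult_ineq)
    also have "\<dots> \<le> N v * l2norm (\<lambda>j. embed_coord j x - embed_coord j y)"
      by (intro mult_left_mono L2_set_le_l2norm summable_embed_diff) (simp add: N_def)
    finally show ?thesis .
  qed
  have "AE x in \<mu>. \<bar>D (g s n v) x\<bar> \<le> l x" if s: "\<bar>s\<bar> \<le> 1" for s n v
  proof -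
    have "g s n v \<in> Lip_b"
      unfolding g_def by (intro Lip_b_add Lip_b_cmult Lip_b_coord e)
    then have "bounded (range (g s n v))" by (simp add: Lip_b_def)
    moreover have "\<bar>g s n v x - g s n v y\<bar> \<le> perturbed_dist \<epsilon> x y" for x y
    proof -
      have "\<bar>real_of_int s * (coord n x - coord n y)\<bar> \<le> 1 * (1 * dist x y)"
        unfolding abs_mult using s by (intro mult_mono lip_bdd_diff[OF lip_bdd_coord]) auto
      moreover have "\<bar>\<epsilon> / N v * (e v x - e v y)\<bar> \<le> \<epsilon> * l2norm (\<lambda>j. embed_coord j x - embed_coord j y)"
      proof (cases "N v = 0")
        case True
        then show ?thesis using \<epsilon> by (simp add: l2norm_nonneg summable_embed_diff)
      next
        case False
        then have "0 < N v" by (simp add: N_def order_less_le)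
        then show ?thesis
          using mult_left_mono[OF e_diff[of v x y], of "\<epsilon> / N v"] \<epsilon> by (simp add: abs_mult)
      qed
      moreover have "g s n v x - g s n v y
          = real_of_int s * (coord n x - coord n y) + \<epsilon> / N v * (e v x - e v y)"
        by (simp add: g_def algebra_simps)
      ultimately show ?thesis
        unfolding perturbed_dist_def by linarith
    qed
    ultimately show ?thesis
      using l by (simp add: local_norm_bound_def)
  qed
  then have "AE x in \<mu>. \<forall>s n v. \<bar>s\<bar> \<le> 1 \<longrightarrow> \<bar>D (g s n v) x\<bar> \<le> l x"
    by (simp add: AE_all_countable)
  moreover have "AE x in \<mu>. \<forall>s n v. D (g s n v) x = real_of_int s * D (coord n) x + \<epsilon> / N v * D (e v) x"
    unfolding AE_all_countable g_def by (intro allI D_linear Lip_b_coord e)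
  moreover have "AE x in \<mu>. \<forall>v. D (e v) x = (\<Sum>j<length v. D (\<lambda>y. real_of_int (v ! j) * embed_coord j y) x)"
    unfolding AE_all_countable e_def by (intro allI D_sum Lip_b_cmult Lip_b_embed)
  moreover have "AE x in \<mu>. \<forall>(i::int) j. D (\<lambda>y. real_of_int i * embed_coord j y) x = real_of_int i * D (embed_coord j) x"
    unfolding AE_all_countable by (intro allI D_cmult Lip_b_embed)
  ultimately show ?thesis
    using D_coord D_embed
  proof eventually_elim
    case (elim x)
    define w where "w j = (1/2) ^ Suc j * deriv_coord B D j x" for j
    have De: "D (e v) x = (\<Sum>j<length v. real_of_int (v ! j) * w j)" for v
      using elim by (simp add: w_def del: power_Suc)
    have "\<bar>deriv_coord B D n x\<bar> \<le> l x - \<epsilon> * l2_deriv B D x" for n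
    proof -
      \<comment> \<open>\<open>T\<close> is the room that \<open>l x\<close> leaves beside
        coordinate \<open>n\<close>. The aim is to fit \<open>\<epsilon> * l2_deriv B D x\<close>
        into it for every \<open>n\<close>; the supremum over \<open>n\<close> is taken
        last.\<close>
      define T where "T = l x - \<bar>deriv_coord B D n x\<bar>"
      define s :: int where "s = (if 0 \<le> deriv_coord B D n x then 1 else -1)"
      have s: "\<bar>s\<bar> \<le> 1" "real_of_int s * deriv_coord B D n x = \<bar>deriv_coord B D n x\<bar>"
        by (auto simp: s_def)
      have main: "\<epsilon> / N v * (\<Sum>j<length v. real_of_int (v ! j) * w j) \<le> T" for v
      proof -
        have "D (g s n v) x = \<bar>deriv_coord B D n x\<bar> + \<epsilon> / N v * (\<Sum>j<length v. real_of_int (v ! j) * w j)"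
          using elim(2,5) by (simp add: De s(2))
        moreover have "\<bar>D (g s n v) x\<bar> \<le> l x"
          using elim(1) s(1) by blast
        ultimately show ?thesis by (simp add: T_def)
      qed
      \<comment> \<open>For the empty vector the embedded term is 0, so only the coordinate term is
        compared with \<open>l x\<close>.\<close>
      have T: "0 \<le> T" using main[of "[]"] by simp
      have "\<epsilon> * (\<Sum>j<length v. real_of_int (v ! j) * w j) \<le> T * N v" for v
      proof (cases "N v = 0")
        case True
        then have "\<forall>j\<in>{..<length v}. real_of_int (v ! j) = 0"
          unfolding N_def by (subst (asm) L2_set_eq_0_iff) auto
        then show ?thesis using True by simp
      next
        case False
        then have "0 < N v" by (simp add: N_def order_less_le)
        then show ?thesis using main[of v] by (simp add: field_simps)
      qed
      then have le: "\<epsilon> * L2_set w {..<m} \<le> T" for m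
        unfolding N_def using T \<epsilon> by (rule L2_set_le_by_duality)
      have "(\<lambda>m. L2_set w {..<m}) \<longlonglongrightarrow> l2_deriv B D x"
        unfolding w_def l2_deriv_def by (rule L2_set_tendsto_l2norm[OF summable_deriv_coord[OF B_nonneg]])
      then have "\<epsilon> * l2_deriv B D x \<le> T"
        by (intro LIMSEQ_le_const2[OF tendsto_mult[OF tendsto_const]]) (use le in auto)
      then show ?thesis by (simp add: T_def)
    qed
    then have "sup_deriv B D x \<le> l x - \<epsilon> * l2_deriv B D x"
      by (rule sup_deriv_le[OF B_nonneg])
    then show ?case by simp
  qed
qed

text \<open>The right-hand side is a bound and lies below every other bound. Hence the choice in
  \<open>local_norm\<close> has a candidate, and two least bounds agree almost everywhere.\<close>

lemma local_norm_perturbed: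
  "AE x in \<mu>. local_norm \<mu> (perturbed_dist \<epsilon>) D x = sup_deriv B D x + \<epsilon> * l2_deriv B D x"
proof -
  let ?L = "\<lambda>x. sup_deriv B D x + \<epsilon> * l2_deriv B D x"
  let ?P = "\<lambda>l. local_norm_bound \<mu> (perturbed_dist \<epsilon>) D l \<and>
     (\<forall>l'. local_norm_bound \<mu> (perturbed_dist \<epsilon>) D l' \<longrightarrow> (AE x in \<mu>. l x \<le> l' x))"
  have "?L \<in> Linf \<mu>"
    by (intro Linf_add Linf_mult sup_deriv_Linf l2_deriv_Linf Linf_bounded[of _ _ \<epsilon>]) (use \<epsilon> in auto)
  moreover have "0 \<le> ?L x" for x
    using \<epsilon> sup_deriv_nonneg[OF B_nonneg, of D x] l2_deriv_nonneg[OF B_nonneg, of D x] by simp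
  moreover have "g \<in> Lip_b" if "bounded (range g)" "\<And>x y. \<bar>g x - g y\<bar> \<le> perturbed_dist \<epsilon> x y" for g
  proof -
    have "(1 + \<epsilon>)-lipschitz_on UNIV g"
      using \<epsilon> order_trans[OF that(2) perturbed_dist_le[OF \<epsilon>]]
      by (auto simp: lipschitz_on_def dist_real_def)
    with that(1) show ?thesis by (auto simp: Lip_b_def)
  qed
  ultimately have L: "local_norm_bound \<mu> (perturbed_dist \<epsilon>) D ?L"
    unfolding local_norm_bound_def by (intro conjI AE_I2 allI impI D_le_perturbed) auto
  then have "?P ?L"
    by (intro conjI allI impI perturbed_le_local_norm_bound)
  then have "?P (local_norm \<mu> (perturbed_dist \<epsilon>) D)"
    unfolding local_norm_def by (rule someI[of ?P])
  then have "AE x in \<mu>. local_norm \<mu> (perturbed_dist \<epsilon>) D x \<le> ?L x"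
    and "AE x in \<mu>. ?L x \<le> local_norm \<mu> (perturbed_dist \<epsilon>) D x"
    using L perturbed_le_local_norm_bound by auto
  then show ?thesis by eventually_elim simp
qed

end

end

subsection \<open>Strict convexity\<close>

text \<open>A multiple of \<open>f\<close> is 1-Lipschitz for \<open>dist\<close>, and the functions
  \<open>coord j\<close> are the truncated distances for that metric. So
  \<open>D_bound_lipschitz\<close> applies with the bound 0 on \<open>A\<close>.\<close>

lemma (in weak_derivation) D_eq_0_of_coord:
  assumes A: "A \<in> sets \<mu>" and coord: "AE x in \<mu>. x \<in> A \<longrightarrow> (\<forall>j. D (coord j) x = 0)"
    and f: "f \<in> Lip_b"
  shows "AE x in \<mu>. x \<in> A \<longrightarrow> D f x = 0"
proof -
  obtain K where K: "lip_bdd K f" using f by (auto simp: Lip_b_iff)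
  then have K0: "0 \<le> K" by (rule lip_bdd_nonneg)
  define c where "c = 1 / (K + 1)"
  have c: "0 < c" "c * K \<le> 1" using K0 by (auto simp: c_def field_simps)
  have "lip_bdd (\<bar>c\<bar> * K) (\<lambda>x. c * f x)"
    by (rule lip_bdd_cmult[OF K])
  then have g: "lip_bdd 1 (\<lambda>x. c * f x)"
    by (rule lip_bdd_mono) (use c in simp)
  have "AE x in \<mu>. x \<in> A \<longrightarrow> \<bar>D (\<lambda>x. c * f x) x\<bar> \<le> 0"
  proof (rule D_bound_lipschitz[OF dense_seq, where \<rho> = dist and K = 1])
    show "AE x in \<mu>. x \<in> A \<longrightarrow> \<bar>D (\<lambda>y. min 1 (dist (dense_seq n) y)) x\<bar> \<le> 0" for n
      using coord unfolding coord_def[symmetric, abs_def] by eventually_elim auto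
    show "\<bar>c * f x - c * f y\<bar> \<le> dist x y" for x y
      using lip_bdd_diff[OF g] by simp
  qed (auto simp: A dist_commute dist_triangle intro: Lip_bI[OF g])
  with D_cmult[OF f, of c] show ?thesis
    by eventually_elim (use c in auto)
qed

text \<open>On \<open>V\<close> the ratio of the two l2 parts is at most 1, which makes it an
  admissible coefficient. The derivations can be exchanged to obtain the other half of strict
  convexity.\<close>

lemma proportional_on_sublevel:
  assumes 1: "bounded_weak_derivation \<mu> D\<^sub>1 B" and 2: "bounded_weak_derivation \<mu> D\<^sub>2 B"
    and U: "U \<in> sets borel"
    and parallel: "\<And>f. f \<in> Lip_b \<Longrightarrow> AE x in \<mu>. x \<in> U \<longrightarrow>
      l2_deriv B D\<^sub>2 x * D\<^sub>1 f x = l2_deriv B D\<^sub>1 x * D\<^sub>2 f x"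
  defines "V \<equiv> {x \<in> U. l2_deriv B D\<^sub>1 x \<le> l2_deriv B D\<^sub>2 x}"
  shows "\<exists>l. V \<in> sets borel \<and> l \<in> Linf \<mu> \<and> (\<forall>x. 0 \<le> l x) \<and> (\<forall>x. x \<notin> V \<longrightarrow> l x = 0) \<and>
    (\<forall>f\<in>Lip_b. AE x in \<mu>. indicator V x * D\<^sub>1 f x = l x * D\<^sub>2 f x)"
proof -
  interpret D1: bounded_weak_derivation \<mu> D\<^sub>1 B by (rule 1)
  interpret D2: bounded_weak_derivation \<mu> D\<^sub>2 B by (rule 2)
  let ?q1 = "l2_deriv B D\<^sub>1" and ?q2 = "l2_deriv B D\<^sub>2"
  note sets = D1.sets_borel
  have q_borel: "h \<in> borel_measurable borel" if "h \<in> Linf \<mu>" for h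
    using Linf_measurable[OF that] measurable_cong_sets[OF sets refl] by auto
  have [measurable]: "?q1 \<in> borel_measurable borel" "?q2 \<in> borel_measurable borel"
    by (auto intro: q_borel D1.l2_deriv_Linf D2.l2_deriv_Linf)
  note [measurable] = U
  have V[measurable]: "V \<in> sets borel"
    unfolding V_def by measurable
  have nonneg: "0 \<le> ?q1 x" "0 \<le> ?q2 x" for x
    by (auto intro: l2_deriv_nonneg D1.B_nonneg)
  \<comment> \<open>Division by 0 gives the value 0 where \<open>?q2\<close> vanishes. On
    \<open>V\<close> also \<open>?q1\<close> vanishes there, and then so does
    \<open>D\<^sub>1 f\<close> almost everywhere.\<close>
  define l where "l x = indicator V x * (?q1 x / ?q2 x)" for x
  have l_nonneg: "0 \<le> l x" for x
    using nonneg[of x] by (simp add: l_def)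
  have l_le: "l x \<le> 1" for x
    using nonneg[of x] by (auto simp: l_def V_def divide_le_eq split: split_indicator)
  have "l \<in> borel_measurable borel"
    unfolding l_def by measurable
  then have l: "l \<in> Linf \<mu>"
    using l_nonneg l_le measurable_cong_sets[OF sets refl] by (intro Linf_bounded[of _ _ 1]) auto
  have zero: "AE x in \<mu>. x \<in> {x. ?q1 x = 0} \<longrightarrow> D\<^sub>1 f x = 0" if "f \<in> Lip_b" for f
  proof (rule D1.D_eq_0_of_coord[OF _ _ that])
    show "{x. ?q1 x = 0} \<in> sets \<mu>"
      unfolding sets by measurable
    show "AE x in \<mu>. x \<in> {x. ?q1 x = 0} \<longrightarrow> (\<forall>j. D\<^sub>1 (coord j) x = 0)"
      using D1.D_coord by eventually_elim (auto intro: deriv_coord_eq_0[OF D1.B_nonneg])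
  qed
  have "AE x in \<mu>. indicator V x * D\<^sub>1 f x = l x * D\<^sub>2 f x" if f: "f \<in> Lip_b" for f
    using parallel[OF f] zero[OF f]
  proof eventually_elim
    case (elim x)
    show ?case
    proof (cases "x \<in> V")
      case True
      then have "x \<in> U" "?q1 x \<le> ?q2 x" by (auto simp: V_def)
      show ?thesis
      proof (cases "?q2 x = 0")
        case True
        with \<open>?q1 x \<le> ?q2 x\<close> nonneg[of x] have "?q1 x = 0" by simp
        with elim show ?thesis by (simp add: l_def)
      next
        case False
        with elim \<open>x \<in> U\<close> \<open>x \<in> V\<close> show ?thesis by (simp add: l_def field_simps)
      qed
    qed (simp add: l_def)
  qed
  moreover have "l x = 0" if "x \<notin> V" for x using that by (simp add: l_def)
  ultimately show ?thesis
    using V l l_nonneg by blast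
qed

theorem theorem7p124:
  fixes \<mu> :: "'a::polish_space measure" and \<epsilon> :: real
  assumes "radon_measure \<mu>" and "\<epsilon> > 0"
  shows "\<exists>d' :: 'a \<Rightarrow> 'a \<Rightarrow> real.
           Metric_space UNIV d' \<and>
           (\<forall>x y. dist x y \<le> d' x y \<and> d' x y \<le> (1 + \<epsilon>) * dist x y) \<and>
           strictly_convex_local_norm \<mu> d'"
proof (intro exI[of _ "perturbed_dist \<epsilon>"] conjI allI)
  note \<mu> = \<open>radon_measure \<mu>\<close> and \<epsilon> = \<open>\<epsilon> > 0\<close>
  show "Metric_space UNIV (perturbed_dist \<epsilon> :: 'a \<Rightarrow> 'a \<Rightarrow> real)"
    by (rule Metric_space_perturbed_dist[OF \<epsilon>])
  show "dist x y \<le> perturbed_dist \<epsilon> x y" "perturbed_dist \<epsilon> x y \<le> (1 + \<epsilon>) * dist x y" for x y :: 'a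
    by (rule dist_le_perturbed_dist[OF \<epsilon>] perturbed_dist_le[OF \<epsilon>])+
  show "strictly_convex_local_norm \<mu> (perturbed_dist \<epsilon>)"
    unfolding strictly_convex_local_norm_def
  proof (intro allI impI, elim conjE)
    fix D\<^sub>1 D\<^sub>2 :: "('a \<Rightarrow> real) \<Rightarrow> 'a \<Rightarrow> real" and U :: "'a set"
    assume D: "derivation \<mu> D\<^sub>1" "derivation \<mu> D\<^sub>2" and U: "U \<in> sets borel"
      and eq: "AE x in \<mu>. x \<in> U \<longrightarrow> local_norm \<mu> (perturbed_dist \<epsilon>) (\<lambda>f x. D\<^sub>1 f x + D\<^sub>2 f x) x
        = local_norm \<mu> (perturbed_dist \<epsilon>) D\<^sub>1 x + local_norm \<mu> (perturbed_dist \<epsilon>) D\<^sub>2 x"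
    obtain B1 where B1: "\<And>f. lip_bdd 1 f \<Longrightarrow> AE x in \<mu>. \<bar>D\<^sub>1 f x\<bar> \<le> B1"
      using D(1) by (rule derivation_bounded) blast
    obtain B2 where B2: "\<And>f. lip_bdd 1 f \<Longrightarrow> AE x in \<mu>. \<bar>D\<^sub>2 f x\<bar> \<le> B2"
      using D(2) by (rule derivation_bounded) blast
    \<comment> \<open>The sum of the two bounds also controls the coordinate derivatives of
      \<open>D\<^sub>1 + D\<^sub>2\<close>.\<close>
    define B where "B = max 0 B1 + max 0 B2"
    have B: "0 \<le> B" by (simp add: B_def)
    let ?S = "\<lambda>f x. D\<^sub>1 f x + D\<^sub>2 f x"
    have weak: "weak_derivation \<mu> D\<^sub>1" "weak_derivation \<mu> D\<^sub>2"
      using D by (auto intro: derivation_imp_weak_derivation[OF \<mu>])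
    have one: "(\<lambda>_. 1) \<in> Linf \<mu>" by (rule Linf_bounded[of _ _ 1]) auto
    have bdd: "AE x in \<mu>. \<bar>D\<^sub>1 (coord j) x\<bar> \<le> max 0 B1" "AE x in \<mu>. \<bar>D\<^sub>2 (coord j) x\<bar> \<le> max 0 B2" for j
      using B1[OF lip_bdd_coord[of j]] B2[OF lip_bdd_coord[of j]] by (auto elim: eventually_mono)
    interpret D1: bounded_weak_derivation \<mu> D\<^sub>1 B
    proof (intro bounded_weak_derivation.intro bounded_weak_derivation_axioms.intro weak B)
      show "AE x in \<mu>. \<bar>D\<^sub>1 (coord j) x\<bar> \<le> B" for j
        using bdd(1)[of j] by eventually_elim (auto simp: B_def)
    qed
    interpret D2: bounded_weak_derivation \<mu> D\<^sub>2 B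
    proof (intro bounded_weak_derivation.intro bounded_weak_derivation_axioms.intro weak B)
      show "AE x in \<mu>. \<bar>D\<^sub>2 (coord j) x\<bar> \<le> B" for j
        using bdd(2)[of j] by eventually_elim (auto simp: B_def)
    qed
    interpret S: bounded_weak_derivation \<mu> ?S B
    proof (intro bounded_weak_derivation.intro bounded_weak_derivation_axioms.intro B)
      show "weak_derivation \<mu> ?S"
        using weak_derivation_combination[OF weak one one] by simp
      show "AE x in \<mu>. \<bar>D\<^sub>1 (coord j) x + D\<^sub>2 (coord j) x\<bar> \<le> B" for j
        using bdd[of j] by eventually_elim (auto simp: B_def)
    qed
    let ?q1 = "l2_deriv B D\<^sub>1" and ?q2 = "l2_deriv B D\<^sub>2"
    have coord: "AE x in \<mu>. x \<in> U \<longrightarrow> (\<forall>j. ?q2 x * D\<^sub>1 (coord j) x = ?q1 x * D\<^sub>2 (coord j) x)"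
      using eq D1.local_norm_perturbed[OF \<epsilon>] D2.local_norm_perturbed[OF \<epsilon>] S.local_norm_perturbed[OF \<epsilon>]
        D1.D_coord D2.D_coord S.D_coord
    proof eventually_elim
      case (elim x)
      \<comment> \<open>At this point none of the three truncations is active, so the truncated
        derivatives are additive.\<close>
      have add: "deriv_coord B ?S j x = deriv_coord B D\<^sub>1 j x + deriv_coord B D\<^sub>2 j x" for j
        using elim(5-7) by metis
      show ?case
      proof (intro impI allI)
        fix j assume "x \<in> U"
        \<comment> \<open>The supremum part is subadditive. Equality of the local norms therefore
          forces the reverse triangle inequality for the l2 part.\<close>
        have "sup_deriv B ?S x \<le> sup_deriv B D\<^sub>1 x + sup_deriv B D\<^sub>2 x"
        proof (rule sup_deriv_le[OF B])
          show "\<bar>deriv_coord B ?S j x\<bar> \<le> sup_deriv B D\<^sub>1 x + sup_deriv B D\<^sub>2 x" for j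
            unfolding add
            by (intro order_trans[OF abs_triangle_ineq] add_mono deriv_coord_le_sup[OF B])
        qed
        then have "\<epsilon> * (?q1 x + ?q2 x) \<le> \<epsilon> * l2_deriv B ?S x"
          using elim(1-4) \<open>x \<in> U\<close> by (simp add: distrib_left)
        then have "?q1 x + ?q2 x \<le> l2_deriv B ?S x"
          using \<epsilon> by simp
        then have "?q2 x * ((1/2) ^ Suc j * deriv_coord B D\<^sub>1 j x) = ?q1 x * ((1/2) ^ Suc j * deriv_coord B D\<^sub>2 j x)"
          unfolding l2_deriv_def add distrib_left
          by (rule l2norm_triangle_eq_imp_parallel[OF summable_deriv_coord[OF B] summable_deriv_coord[OF B]])
        then show "?q2 x * D\<^sub>1 (coord j) x = ?q1 x * D\<^sub>2 (coord j) x"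
          using elim(5,6) by simp
      qed
    qed
    have parallel: "AE x in \<mu>. x \<in> U \<longrightarrow> ?q2 x * D\<^sub>1 f x = ?q1 x * D\<^sub>2 f x" if f: "f \<in> Lip_b" for f
    proof -
      \<comment> \<open>The combination with coefficients \<open>?q2\<close> and
        \<open>- ?q1\<close> is again a weak derivation. It kills all coordinates on
        \<open>U\<close>, hence every function in \<open>Lip_b\<close>.\<close>
      have "(\<lambda>x. 0 - ?q1 x) \<in> Linf \<mu>"
        by (intro Linf_diff D1.l2_deriv_Linf Linf_bounded[of _ _ 0]) auto
      then interpret E: weak_derivation \<mu> "\<lambda>f x. ?q2 x * D\<^sub>1 f x + (0 - ?q1 x) * D\<^sub>2 f x"
        by (rule weak_derivation_combination[OF weak D2.l2_deriv_Linf])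
      have "AE x in \<mu>. x \<in> U \<longrightarrow> ?q2 x * D\<^sub>1 f x + (0 - ?q1 x) * D\<^sub>2 f x = 0"
      proof (rule E.D_eq_0_of_coord[OF _ _ f])
        show "U \<in> sets \<mu>" using U by (simp add: D1.sets_borel)
        show "AE x in \<mu>. x \<in> U \<longrightarrow> (\<forall>j. ?q2 x * D\<^sub>1 (coord j) x + (0 - ?q1 x) * D\<^sub>2 (coord j) x = 0)"
          using coord by eventually_elim simp
      qed
      then show ?thesis by eventually_elim simp
    qed
    have bw: "bounded_weak_derivation \<mu> D\<^sub>1 B" "bounded_weak_derivation \<mu> D\<^sub>2 B" ..
    \<comment> \<open>Comparing the two l2 parts pointwise covers \<open>U\<close> by two sets; on
      each one the coefficient divides the smaller part by the larger.\<close>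
    define V\<^sub>1 where "V\<^sub>1 = {x \<in> U. ?q1 x \<le> ?q2 x}"
    define V\<^sub>2 where "V\<^sub>2 = {x \<in> U. ?q2 x \<le> ?q1 x}"
    obtain l\<^sub>1 where l1: "V\<^sub>1 \<in> sets borel" "l\<^sub>1 \<in> Linf \<mu>" "\<forall>x. 0 \<le> l\<^sub>1 x" "\<forall>x. x \<notin> V\<^sub>1 \<longrightarrow> l\<^sub>1 x = 0"
        "\<forall>f\<in>Lip_b. AE x in \<mu>. indicator V\<^sub>1 x * D\<^sub>1 f x = l\<^sub>1 x * D\<^sub>2 f x"
      using proportional_on_sublevel[OF bw U parallel] unfolding V\<^sub>1_def by blast
    have "AE x in \<mu>. x \<in> U \<longrightarrow> ?q1 x * D\<^sub>2 f x = ?q2 x * D\<^sub>1 f x" if "f \<in> Lip_b" for f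
      using parallel[OF that] by eventually_elim simp
    then obtain l\<^sub>2 where l2: "V\<^sub>2 \<in> sets borel" "l\<^sub>2 \<in> Linf \<mu>" "\<forall>x. 0 \<le> l\<^sub>2 x" "\<forall>x. x \<notin> V\<^sub>2 \<longrightarrow> l\<^sub>2 x = 0"
        "\<forall>f\<in>Lip_b. AE x in \<mu>. indicator V\<^sub>2 x * D\<^sub>2 f x = l\<^sub>2 x * D\<^sub>1 f x"
      using proportional_on_sublevel[OF bw(2,1) U] unfolding V\<^sub>2_def by blast
    have empty: "U - (V\<^sub>1 \<union> V\<^sub>2) = {}" by (auto simp: V\<^sub>1_def V\<^sub>2_def)
    have "emeasure \<mu> (U - (V\<^sub>1 \<union> V\<^sub>2)) = 0" by (simp only: empty emeasure_empty)
    then show "\<exists>V\<^sub>1 V\<^sub>2 l\<^sub>1 l\<^sub>2.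
        V\<^sub>1 \<in> sets borel \<and> V\<^sub>2 \<in> sets borel \<and>
        l\<^sub>1 \<in> Linf \<mu> \<and> (\<forall>x. 0 \<le> l\<^sub>1 x) \<and> (\<forall>x. x \<notin> V\<^sub>1 \<longrightarrow> l\<^sub>1 x = 0) \<and>
        l\<^sub>2 \<in> Linf \<mu> \<and> (\<forall>x. 0 \<le> l\<^sub>2 x) \<and> (\<forall>x. x \<notin> V\<^sub>2 \<longrightarrow> l\<^sub>2 x = 0) \<and>
        emeasure \<mu> (U - (V\<^sub>1 \<union> V\<^sub>2)) = 0 \<and>
        (\<forall>f\<in>Lip_b. AE x in \<mu>. indicator V\<^sub>1 x * D\<^sub>1 f x = l\<^sub>1 x * D\<^sub>2 f x) \<and>
        (\<forall>f\<in>Lip_b. AE x in \<mu>. indicator V\<^sub>2 x * D\<^sub>2 f x = l\<^sub>2 x * D\<^sub>1 f x)"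
      using l1 l2 by (intro exI[of _ V\<^sub>1] exI[of _ V\<^sub>2] exI[of _ l\<^sub>1] exI[of _ l\<^sub>2] conjI)
  qed
qed

end
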